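(* Let $G$ be a finite simple undirected graph that is 2-connected. Let $n$ be the number of vertices of $G$, $p$ the order of a longest path in $G$, $c$ the order of a longest cycle in $G$, and $\kappa$ the connectivity of $G$. If $$\frac{1}{3}\sigma_3\ge \frac{p+\kappa}{3},$$ then $c=p=n$ (in particular, $G$ is hamiltonian).
   Context: All graphs are finite, undirected, without loops or multiple edges. The order of a path or cycle is its number of vertices. The connectivity $\kappa$ is the usual vertex connectivity (with $\kappa(K_n)=n-1$), and $G$ is $k$-connected if $\kappa\ge k$. Let $\alpha$ be the independence number of $G$. If $\alpha\ge 3$, $\sigma_3$ denotes the minimum of $d(x)+d(y)+d(z)$ over all independent sets $\{x,y,z\}$ of three distinct vertices of $G$; if $\alpha<3$, then $\sigma_3=+\infty$ (so the hypothesis on $\sigma_3$ holds automatically). By convention a single vertex and a single edge are regarded as cycles of orders 1 and 2, respectively. A graph is hamiltonian if it contains a cycle through all of its vertices. *)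

theory Defs
  imports "HOL-Library.Extended_Real"
begin

definition simple_graph :: "'a set \<Rightarrow> 'a set set \<Rightarrow> bool" where
  "simple_graph V E \<longleftrightarrow> finite V \<and> (\<forall>e\<in>E. e \<subseteq> V \<and> card e = 2)"

definition vertex_degree :: "'a set \<Rightarrow> 'a set set \<Rightarrow> 'a \<Rightarrow> nat" where
  "vertex_degree V E x = card {y \<in> V. {x, y} \<in> E}"

definition is_path :: "'a set \<Rightarrow> 'a set set \<Rightarrow> 'a list \<Rightarrow> bool" where
  "is_path V E xs \<longleftrightarrow>
     xs \<noteq> [] \<and> set xs \<subseteq> V \<and> distinct xs \<and> successively (\<lambda>x y. {x, y} \<in> E) xs"

(* No closing edge is required of lists of length 1 or 2: a single vertex and a
   single edge count as cycles of orders 1 and 2. *)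
definition is_cycle :: "'a set \<Rightarrow> 'a set set \<Rightarrow> 'a list \<Rightarrow> bool" where
  "is_cycle V E xs \<longleftrightarrow> is_path V E xs \<and> (length xs \<ge> 3 \<longrightarrow> {last xs, hd xs} \<in> E)"

definition longest_path_order :: "'a set \<Rightarrow> 'a set set \<Rightarrow> nat" where
  "longest_path_order V E = Max {length xs | xs. is_path V E xs}"

definition longest_cycle_order :: "'a set \<Rightarrow> 'a set set \<Rightarrow> nat" where
  "longest_cycle_order V E = Max {length xs | xs. is_cycle V E xs}"

definition hamiltonian :: "'a set \<Rightarrow> 'a set set \<Rightarrow> bool" where
  "hamiltonian V E \<longleftrightarrow> (\<exists>xs. is_cycle V E xs \<and> set xs = V)"

definition connected_graph :: "'a set \<Rightarrow> 'a set set \<Rightarrow> bool" where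
  "connected_graph V E \<longleftrightarrow>
     (\<forall>x\<in>V. \<forall>y\<in>V. \<exists>xs. is_path V E xs \<and> hd xs = x \<and> last xs = y)"

definition complete_graph :: "'a set \<Rightarrow> 'a set set \<Rightarrow> bool" where
  "complete_graph V E \<longleftrightarrow> (\<forall>x\<in>V. \<forall>y\<in>V. x \<noteq> y \<longrightarrow> {x, y} \<in> E)"

definition separating :: "'a set \<Rightarrow> 'a set set \<Rightarrow> 'a set \<Rightarrow> bool" where
  "separating V E S \<longleftrightarrow> S \<subseteq> V \<and> \<not> connected_graph (V - S) {e \<in> E. e \<subseteq> V - S}"

definition connectivity :: "'a set \<Rightarrow> 'a set set \<Rightarrow> nat" where
  "connectivity V E =
     (if complete_graph V E then card V - 1 else Min {card S | S. separating V E S})"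

definition k_connected :: "nat \<Rightarrow> 'a set \<Rightarrow> 'a set set \<Rightarrow> bool" where
  "k_connected k V E \<longleftrightarrow> connectivity V E \<ge> k"

definition independent_set :: "'a set \<Rightarrow> 'a set set \<Rightarrow> 'a set \<Rightarrow> bool" where
  "independent_set V E S \<longleftrightarrow> S \<subseteq> V \<and> (\<forall>x\<in>S. \<forall>y\<in>S. {x, y} \<notin> E)"

definition independence_number :: "'a set \<Rightarrow> 'a set set \<Rightarrow> nat" where
  "independence_number V E = Max {card S | S. independent_set V E S}"

definition sigma3 :: "'a set \<Rightarrow> 'a set set \<Rightarrow> enat" where
  "sigma3 V E =
     (if independence_number V E \<ge> 3
      then enat (Min {(\<Sum>x\<in>S. vertex_degree V E x) | S. independent_set V E S \<and> card S = 3})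
      else \<infinity>)"

end

theory Submission imports Defs begin

text \<open>
  Suppose that no cycle has the order \<open>p\<close> of a longest path. First, some cycle has order \<open>p - 1\<close>. If a
  longest path has crossing chords from its two ends, it splits into a cycle and a path attached to it at
  two different vertices; taking this path as short as possible, its first vertex and the two vertices
  following its attachments on the cycle would otherwise form an independent triple of degree sum at
  most \<open>p + 1\<close>. If no longest path has crossing chords, take one whose first vertex
  closes the largest possible initial segment \<open>K\<close> and let \<open>F\<close> be the set of ends of Hamiltonian paths of
  \<open>K\<close> from its last vertex. Two nonadjacent vertices of \<open>F\<close> have degree sum at least \<open>|K| + 2\<close>, so Ore's
  exchange makes \<open>F\<close> an initial segment of each of these paths, and the vertex after \<open>F\<close> is a cut vertex.

  Now let \<open>C\<close> be a cycle of order \<open>p - 1\<close>, \<open>z\<close> a vertex outside, \<open>Z\<close> its neighbourhood (contained in \<open>C\<close>)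
  and \<open>Z'\<close> the set of successors of \<open>Z\<close> on \<open>C\<close>. All of \<open>Z'\<close> has its neighbours in \<open>C - Z'\<close>, and
  counting along the arcs of \<open>C\<close> bounds the degree sums of independent triples made of \<open>z\<close>, elements of
  \<open>Z'\<close>, and vertices across a minimum cut \<open>S\<close>; the last have few common neighbours with the others, since
  these lie in \<open>S\<close>. The bounds contradict the hypothesis wherever \<open>z\<close> lies relative to \<open>S\<close>.
\<close>

section \<open>Counting along lists\<close>

lemma successivelyI:
  assumes "\<And>xs ys. L = xs @ ys \<Longrightarrow> xs \<noteq> [] \<Longrightarrow> ys \<noteq> [] \<Longrightarrow> P (last xs) (hd ys)"
  shows "successively P L"
  using assms
proof (induction L rule: induct_list012)
  case (3 x y zs)
  have "P x y" using "3.prems"[of "[x]"] by simp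
  moreover have "successively P (y # zs)"
  proof (rule "3.IH"(2))
    fix xs ys assume "y # zs = xs @ ys" "xs \<noteq> []" "ys \<noteq> []"
    then show "P (last xs) (hd ys)" using "3.prems"[of "x # xs" ys] by simp
  qed
  ultimately show ?case by simp
qed auto

lemma card_Int_conv_filter:
  assumes "distinct L"
  shows "card (X \<inter> set L) = length (filter (\<lambda>x. x \<in> X) L)"
  using distinct_length_filter[OF assms, of "\<lambda>x. x \<in> X"] by simp

text \<open>Moving each entry of \<open>X\<close> other than the head one place back gives positions
  that avoid \<open>Y\<close> and are not the last one. The two \<open>of_bool\<close> terms pay for
  the head and the last entry, which this shift leaves aside.\<close>

lemma card_consecutive:
  assumes "distinct L" "L \<noteq> []"
    and "\<And>xs ys. L = xs @ ys \<Longrightarrow> xs \<noteq> [] \<Longrightarrow> ys \<noteq> [] \<Longrightarrow> \<not> (hd ys \<in> X \<and> last xs \<in> Y)"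
  shows "card (X \<inter> set L) + card (Y \<inter> set L) + 1
    \<le> length L + of_bool (hd L \<in> X) + of_bool (last L \<in> Y)"
proof -
  let ?f = "\<lambda>X L. length (filter (\<lambda>x. x \<in> X) L)"
  have s: "successively (\<lambda>t t'. \<not> (t' \<in> X \<and> t \<in> Y)) L"
    using assms(3) by (intro successivelyI)
  have "?f X L + ?f Y L + 1 \<le> length L + of_bool (hd L \<in> X) + of_bool (last L \<in> Y)"
    using s assms(2) by (induction L rule: induct_list012) (auto split: if_splits)
  then show ?thesis by (simp add: card_Int_conv_filter[OF assms(1)])
qed

text \<open>Let a position count 1 for lying in \<open>Y\<close>, 1 for lying in \<open>Z\<close>,
  and 1 if the next entry is in \<open>X\<close>. The count exceeds 1 only in
  \<open>Y \<inter> Z\<close>; there it is 2, and the next position counts 0. Only the last position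
  can lack such a compensation, hence the \<open>+ 1\<close>.\<close>

lemma card_consecutive3:
  assumes "distinct L" "L \<noteq> []" "hd L \<notin> X"
    and h1: "\<And>xs ys. L = xs @ ys \<Longrightarrow> xs \<noteq> [] \<Longrightarrow> ys \<noteq> [] \<Longrightarrow> hd ys \<in> X \<Longrightarrow> last xs \<notin> Y \<union> Z"
    and h2: "\<And>xs ys. L = xs @ ys \<Longrightarrow> xs \<noteq> [] \<Longrightarrow> ys \<noteq> [] \<Longrightarrow> last xs \<in> Y \<inter> Z \<Longrightarrow> hd ys \<notin> Y \<union> Z"
    and h3: "\<And>xs t ys. L = xs @ t # ys \<Longrightarrow> xs \<noteq> [] \<Longrightarrow> ys \<noteq> [] \<Longrightarrow> last xs \<in> Y \<inter> Z \<Longrightarrow> hd ys \<notin> X"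
  shows "card (X \<inter> set L) + card (Y \<inter> set L) + card (Z \<inter> set L) \<le> length L + 1"
proof -
  let ?f = "\<lambda>X L. length (filter (\<lambda>x. x \<in> X) L)"
  have "t \<notin> Y \<union> Z" if "L = a @ t # t' # b" "t' \<in> X" for a t t' b
    using h1[of "a @ [t]" "t' # b"] that by simp
  moreover have "t' \<notin> Y \<union> Z" if "L = a @ t # t' # b" "t \<in> Y \<inter> Z" for a t t' b
    using h2[of "a @ [t]" "t' # b"] that by simp
  moreover have "t'' \<notin> X" if "L = a @ t # t' # t'' # b" "t \<in> Y \<inter> Z" for a t t' t'' b
    using h3[of "a @ [t]" t' "t'' # b"] that by simp
  \<comment> \<open>\<open>tl L\<close> counts the entries of \<open>X\<close> that have a
    predecessor, so the induction needs no assumption on the head of the list.\<close>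
  ultimately have "?f X (tl L) + ?f Y L + ?f Z L \<le> length L + 1"
    using assms(2)
  proof (induction "length L" arbitrary: L rule: less_induct)
    case less
    note h1 = less.prems(1) and h2 = less.prems(2) and h3 = less.prems(3)
    consider t where "L = [t]" | t t' where "L = [t, t']" | t t' t'' r where "L = t # t' # t'' # r"
      using less.prems(4) by (metis neq_Nil_conv)
    then show ?case
    proof cases
      case 1 then show ?thesis by simp
    next
      case 2
      then show ?thesis using h1[of "[]" t t'] h2[of "[]" t t'] by auto
    next
      case 3
      have A: "?f X (tl (t' # t'' # r)) + ?f Y (t' # t'' # r) + ?f Z (t' # t'' # r) \<le> length (t' # t'' # r) + 1"
      proof (rule less.hyps)
        show "length (t' # t'' # r) < length L" using 3 by simp
        show "u \<notin> Y \<union> Z" if "t' # t'' # r = a @ u # u' # b" "u' \<in> X" for a u u' b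
          using h1[of "t # a" u u' b] that 3 by simp
        show "u' \<notin> Y \<union> Z" if "t' # t'' # r = a @ u # u' # b" "u \<in> Y \<inter> Z" for a u u' b
          using h2[of "t # a" u u' b] that 3 by simp
        show "u'' \<notin> X" if "t' # t'' # r = a @ u # u' # u'' # b" "u \<in> Y \<inter> Z" for a u u' u'' b
          using h3[of "t # a" u u' u'' b] that 3 by simp
      qed simp
      have B: "?f X (tl (t'' # r)) + ?f Y (t'' # r) + ?f Z (t'' # r) \<le> length (t'' # r) + 1"
      proof (rule less.hyps)
        show "length (t'' # r) < length L" using 3 by simp
        show "u \<notin> Y \<union> Z" if "t'' # r = a @ u # u' # b" "u' \<in> X" for a u u' b
          using h1[of "t # t' # a" u u' b] that 3 by simp
        show "u' \<notin> Y \<union> Z" if "t'' # r = a @ u # u' # b" "u \<in> Y \<inter> Z" for a u u' b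
          using h2[of "t # t' # a" u u' b] that 3 by simp
        show "u'' \<notin> X" if "t'' # r = a @ u # u' # u'' # b" "u \<in> Y \<inter> Z" for a u u' u'' b
          using h3[of "t # t' # a" u u' u'' b] that 3 by simp
      qed simp
      show ?thesis
      proof (cases "t \<in> Y \<inter> Z")
        case True
        then have "t' \<notin> Y \<union> Z" "t'' \<notin> X" "t' \<notin> X"
          using h1[of "[]" t t' "t'' # r"] h2[of "[]" t t' "t'' # r"] h3[of "[]" t t' t'' r] 3 by auto
        then show ?thesis using B 3 by (auto split: if_splits)
      next
        case False
        then show ?thesis using A h1[of "[]" t t' "t'' # r"] 3 by auto
      qed
    qed
  qed
  moreover have "?f X L = ?f X (tl L)" using assms(2,3) by (cases L) auto
  ultimately show ?thesis by (simp add: card_Int_conv_filter[OF assms(1)])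
qed

section \<open>Paths, cycles and separating sets\<close>

locale sgraph =
  fixes V :: "'a set" and E :: "'a set set"
  assumes simple: "simple_graph V E"
begin

definition adj :: "'a \<Rightarrow> 'a \<Rightarrow> bool" where
  "adj x y \<longleftrightarrow> {x, y} \<in> E"

definition nbrs :: "'a \<Rightarrow> 'a set" where
  "nbrs x = {y \<in> V. adj x y}"

definition path :: "'a list \<Rightarrow> bool" where
  "path xs \<longleftrightarrow> xs \<noteq> [] \<and> set xs \<subseteq> V \<and> distinct xs \<and> successively adj xs"

definition cycle :: "'a list \<Rightarrow> bool" where
  "cycle xs \<longleftrightarrow> path xs \<and> 3 \<le> length xs \<and> adj (last xs) (hd xs)"

lemma adj_sym: "adj x y \<longleftrightarrow> adj y x"
  by (simp add: adj_def insert_commute)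

lemma adj_irrefl [simp]: "\<not> adj x x"
  using simple by (force simp: adj_def simple_graph_def)

lemma adj_V: "adj x y \<Longrightarrow> x \<in> V \<and> y \<in> V"
  using simple by (auto simp: adj_def simple_graph_def)

lemma finite_V: "finite V"
  using simple by (simp add: simple_graph_def)

lemma nbrs_iff [simp]: "y \<in> nbrs x \<longleftrightarrow> adj x y"
  using adj_V by (auto simp: nbrs_def)

lemma finite_nbrs [simp]: "finite (nbrs x)"
  using finite_V by (simp add: nbrs_def)

lemma path_iff: "is_path V E xs \<longleftrightarrow> path xs"
  by (simp add: is_path_def path_def adj_def[abs_def])

lemma successively_adj_rev: "successively adj (rev xs) = successively adj xs"
proof -
  have "(\<lambda>x y. adj y x) = adj" by (intro ext) (rule adj_sym)
  then have "successively (\<lambda>x y. adj y x) xs = successively adj xs"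
    by (rule arg_cong[of _ _ "\<lambda>P. successively P xs"])
  then show ?thesis by simp
qed

lemma path_rev [simp]: "path (rev xs) \<longleftrightarrow> path xs"
  by (simp add: path_def successively_adj_rev del: successively_rev)

lemma path_Nil [simp]: "\<not> path []"
  by (simp add: path_def)

lemma path_single [simp]: "path [x] \<longleftrightarrow> x \<in> V"
  by (simp add: path_def)

lemma path_append:
  assumes "xs \<noteq> []" "ys \<noteq> []"
  shows "path (xs @ ys) \<longleftrightarrow> path xs \<and> path ys \<and> set xs \<inter> set ys = {} \<and> adj (last xs) (hd ys)"
  using assms by (auto simp: path_def successively_append_iff)

lemma path_Cons:
  assumes "ys \<noteq> []"
  shows "path (x # ys) \<longleftrightarrow> x \<in> V \<and> path ys \<and> x \<notin> set ys \<and> adj x (hd ys)"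
  using path_append[of "[x]" ys] assms by auto

lemma path_distinct: "path xs \<Longrightarrow> distinct xs"
  and path_subset: "path xs \<Longrightarrow> set xs \<subseteq> V"
  by (simp_all add: path_def)

lemmas path_simps = path_append path_Cons hd_append last_append hd_rev last_rev adj_sym

lemma cycle_rotate:
  assumes "cycle (xs @ ys)"
  shows "cycle (ys @ xs)"
  using assms by (cases "xs = []"; cases "ys = []") (auto simp: cycle_def path_simps)

lemma cycle_last:
  assumes "cycle C" "v \<in> set C"
  obtains L where "cycle L" "set L = set C" "length L = length C" "last L = v"
proof -
  obtain a b where C: "C = a @ v # b" using assms(2) by (auto dest: split_list)
  have "cycle (b @ (a @ [v]))" using cycle_rotate[of "a @ [v]" b] assms(1) C by simp
  then show thesis by (rule that) (auto simp: C)
qed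

text \<open>Ore's exchange: an edge joining the two paths may be simulated when its ends have
  large degree sum.\<close>

lemma join_paths:
  assumes "path xs" "path ys" "set xs \<inter> set ys = {}"
    and "length xs + length ys + 1
      \<le> card (nbrs (last xs) \<inter> (set xs \<union> set ys)) + card (nbrs (hd ys) \<inter> (set xs \<union> set ys))"
  obtains zs where "path zs" "set zs = set xs \<union> set ys" "hd zs = hd xs" "last zs = last ys"
proof (rule ccontr)
  assume "\<not> thesis"
  with that have no: False
    if "path zs" "set zs = set xs \<union> set ys" "hd zs = hd xs" "last zs = last ys" for zs
    using that by blast
  let ?e = "last xs" and ?f = "hd ys"
  have ne: "xs \<noteq> []" "ys \<noteq> []" using assms(1,2) by auto
  \<comment> \<open>If \<open>xs = a @ b\<close> with \<open>hd b\<close> adjacent to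
    \<open>?f\<close> and \<open>last a\<close> adjacent to \<open>?e\<close>, then
    \<open>a @ rev b @ ys\<close> is the desired path. As \<open>?e\<close> is not its own
    neighbour, only the correction for \<open>hd xs\<close> remains; the count on \<open>ys\<close>
    is the mirror image.\<close>
  have "card (nbrs ?f \<inter> set xs) + card (nbrs ?e \<inter> set xs) + 1
    \<le> length xs + of_bool (hd xs \<in> nbrs ?f) + of_bool (last xs \<in> nbrs ?e)"
  proof (rule card_consecutive)
    fix a b assume x: "xs = a @ b" "a \<noteq> []" "b \<noteq> []"
    show "\<not> (hd b \<in> nbrs ?f \<and> last a \<in> nbrs ?e)"
    proof
      assume "hd b \<in> nbrs ?f \<and> last a \<in> nbrs ?e"
      then show False
        using assms(1-3) ne x
        by (intro no[of "a @ rev b @ ys"]) (auto simp: path_simps)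
    qed
  qed (use assms ne in \<open>auto simp: path_distinct\<close>)
  moreover have "card (nbrs ?f \<inter> set ys) + card (nbrs ?e \<inter> set ys) + 1
    \<le> length ys + of_bool (hd ys \<in> nbrs ?f) + of_bool (last ys \<in> nbrs ?e)"
  proof (rule card_consecutive)
    fix a b assume y: "ys = a @ b" "a \<noteq> []" "b \<noteq> []"
    show "\<not> (hd b \<in> nbrs ?f \<and> last a \<in> nbrs ?e)"
    proof
      assume "hd b \<in> nbrs ?f \<and> last a \<in> nbrs ?e"
      then show False
        using assms(1-3) ne y
        by (intro no[of "xs @ rev a @ b"]) (auto simp: path_simps)
    qed
  qed (use assms ne in \<open>auto simp: path_distinct\<close>)
  moreover have "card (nbrs v \<inter> (set xs \<union> set ys)) = card (nbrs v \<inter> set xs) + card (nbrs v \<inter> set ys)" for v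
    unfolding Int_Un_distrib using assms(3) by (intro card_Un_disjoint) auto
  moreover have "of_bool (hd xs \<in> nbrs ?f) \<le> (1::nat)" "of_bool (last ys \<in> nbrs ?e) \<le> (1::nat)"
    by auto
  ultimately show False using assms(4) by simp
qed

section \<open>Successors on a cycle\<close>

definition next_in :: "'a list \<Rightarrow> 'a \<Rightarrow> 'a" where
  "next_in C v = C ! (Suc (THE i. i < length C \<and> C ! i = v) mod length C)"

lemma next_in_nth:
  assumes "distinct C" "C \<noteq> []"
  shows "next_in C (C ! (i mod length C)) = C ! (Suc i mod length C)"
proof -
  have "(THE j. j < length C \<and> C ! j = C ! (i mod length C)) = i mod length C"
    using assms by (intro the_equality) (auto simp: nth_eq_iff_index_eq)
  then show ?thesis by (simp add: next_in_def mod_Suc_eq)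
qed

lemma inj_on_next_in:
  assumes "distinct C"
  shows "inj_on (next_in C) (set C)"
proof (rule finite_surj_inj)
  \<comment> \<open>A surjection of a finite set onto itself is injective. The preimage sits one
    place earlier; adding the length first makes this work at index 0.\<close>
  show "set C \<subseteq> next_in C ` set C"
  proof
    fix x assume "x \<in> set C"
    then obtain j where j: "j < length C" "x = C ! j" by (auto simp: in_set_conv_nth)
    then have "C \<noteq> []" by auto
    have "next_in C (C ! ((j + length C - 1) mod length C)) = C ! (Suc (j + length C - 1) mod length C)"
      by (rule next_in_nth[OF assms \<open>C \<noteq> []\<close>])
    also have "Suc (j + length C - 1) = j + length C" using \<open>C \<noteq> []\<close> by (cases C) auto
    also have "C ! ((j + length C) mod length C) = x" using j by simp
    finally show "x \<in> next_in C ` set C" using \<open>C \<noteq> []\<close> by (intro image_eqI) auto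
  qed
qed simp

text \<open>Rotation preserves cyclic successors. As \<open>next_in\<close> refers to the fixed list
  \<open>C\<close>, arguments that open the cycle at different vertices speak of the same
  successors.\<close>

lemma rotate_to:
  assumes C: "cycle C" and v: "v \<in> set C"
  obtains L where "cycle L" "set L = set C" "length L = length C" "last L = v" "hd L = next_in C v"
    "\<forall>a b. L = a @ b \<longrightarrow> a \<noteq> [] \<longrightarrow> b \<noteq> [] \<longrightarrow> hd b = next_in C (last a)"
proof -
  have d: "distinct C" "C \<noteq> []" using C by (auto simp: cycle_def path_def)
  obtain i where i: "i < length C" "v = C ! i" using v by (auto simp: in_set_conv_nth)
  define L where "L = rotate (Suc i) C"
  have nth: "L ! j = C ! ((Suc i + j) mod length C)" if "j < length C" for j
    using that by (simp add: L_def nth_rotate del: rotate_Suc)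
  have len: "length L = length C" by (simp add: L_def)
  then have ne: "L \<noteq> []" using d by auto
  have "cycle L"
    using cycle_rotate[of "take (Suc i mod length C) C" "drop (Suc i mod length C) C"] C
    by (simp add: L_def rotate_drop_take del: rotate_Suc)
  have "set L = set C" by (simp add: L_def del: rotate_Suc)
  have "last L = v"
    using nth[of "length C - 1"] i d by (simp add: last_conv_nth[OF ne] len)
  have "hd L = next_in C v"
    using nth[of 0] i d next_in_nth[OF d, of i] by (simp add: hd_conv_nth[OF ne])
  have "hd b = next_in C (last a)" if ab: "L = a @ b" "a \<noteq> []" "b \<noteq> []" for a b
  proof -
    have "0 < length b" "length a + length b = length C" using ab len by auto
    then have l: "0 < length a" "length a < length C" using ab(2) by (simp, linarith)
    have "hd b = L ! length a" using ab by (simp add: hd_conv_nth nth_append)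
    also have "\<dots> = C ! (Suc (i + length a) mod length C)" using nth[of "length a"] l by simp
    also have "\<dots> = next_in C (C ! ((i + length a) mod length C))" by (simp add: next_in_nth[OF d])
    also have "C ! ((i + length a) mod length C) = L ! (length a - 1)" using nth[of "length a - 1"] l by simp
    also have "\<dots> = last a" using ab l by (simp add: last_conv_nth nth_append)
    finally show ?thesis .
  qed
  then have "\<forall>a b. L = a @ b \<longrightarrow> a \<noteq> [] \<longrightarrow> b \<noteq> [] \<longrightarrow> hd b = next_in C (last a)" by blast
  with \<open>cycle L\<close> \<open>set L = set C\<close> len \<open>last L = v\<close> \<open>hd L = next_in C v\<close> show thesis by (rule that)
qed

section \<open>Separating sets and connectivity\<close>

lemma separating_reachable:
  assumes "separating V E S"
  obtains A where "A \<subseteq> V - S" "A \<noteq> {}" "A \<noteq> V - S" "\<forall>a\<in>A. \<forall>b\<in>V - S - A. \<not> adj a b"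
proof -
  define W where "W = V - S"
  define E' where "E' = {e \<in> E. e \<subseteq> W}"
  have "\<not> connected_graph W E'" using assms by (simp add: separating_def W_def E'_def)
  then obtain x y where xy: "x \<in> W" "y \<in> W" and no: "\<not> (\<exists>xs. is_path W E' xs \<and> hd xs = x \<and> last xs = y)"
    unfolding connected_graph_def by meson
  \<comment> \<open>These are the vertices reachable from \<open>x\<close> outside \<open>S\<close>;
    \<open>y\<close> witnesses that they are not all of \<open>W\<close>.\<close>
  define A where "A = {v. \<exists>xs. is_path W E' xs \<and> hd xs = x \<and> last xs = v}"
  have A: "last xs \<in> A" if "is_path W E' xs" "hd xs = x" for xs using that by (auto simp: A_def)
  have "is_path W E' [x]" using xy by (simp add: is_path_def)
  then have "x \<in> A" using A[of "[x]"] by simp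
  have "y \<notin> A" using no by (simp add: A_def)
  have sub: "A \<subseteq> W"
  proof
    fix v assume "v \<in> A"
    then obtain xs where "is_path W E' xs" "last xs = v" unfolding A_def by blast
    then show "v \<in> W" using last_in_set[of xs] by (auto simp: is_path_def)
  qed
  have "\<not> adj a b" if ab: "a \<in> A" "b \<in> W - A" for a b
  proof
    assume "adj a b"
    obtain xs where xs: "is_path W E' xs" "hd xs = x" "last xs = a" using ab(1) unfolding A_def by blast
    have "b \<notin> set xs"
    proof
      assume "b \<in> set xs"
      then obtain u w where u: "xs = (u @ [b]) @ w" by (metis append.assoc append_Cons append_Nil split_list)
      then have "is_path W E' (u @ [b])"
        using xs(1) successively_append_iff[of _ "u @ [b]" w] by (simp add: is_path_def)
      moreover have "hd (u @ [b]) = x" using xs(2) u by (cases u) simp_all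
      ultimately have "b \<in> A" using A[of "u @ [b]"] by simp
      then show False using ab(2) by blast
    qed
    moreover have "{a, b} \<in> E'" using \<open>adj a b\<close> ab sub by (auto simp: adj_def E'_def)
    ultimately have "is_path W E' (xs @ [b])" "hd (xs @ [b]) = x"
      using xs ab(2) by (simp_all add: is_path_def successively_append_iff)
    then have "b \<in> A" using A[of "xs @ [b]"] by simp
    then show False using ab(2) by blast
  qed
  then have "\<forall>a\<in>A. \<forall>b\<in>W - A. \<not> adj a b" by blast
  moreover have "A \<noteq> {}" "A \<noteq> W" using \<open>x \<in> A\<close> \<open>y \<notin> A\<close> xy by auto
  ultimately show thesis using sub unfolding W_def by (intro that)
qed

text \<open>A path that starts in \<open>A\<close> and avoids \<open>S\<close> never leaves
  \<open>A\<close>. Together with \<open>separating_reachable\<close> this replaces paths by sets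
  closed under adjacency.\<close>

lemma closed_imp_separating:
  assumes "S \<subseteq> V" "A \<subseteq> V - S" "A \<noteq> {}" "A \<noteq> V - S" "\<forall>a\<in>A. \<forall>b\<in>V - S - A. \<not> adj a b"
  shows "separating V E S"
proof -
  define W where "W = V - S"
  define E' where "E' = {e \<in> E. e \<subseteq> W}"
  obtain x where x: "x \<in> A" using assms(3) by blast
  obtain y where y: "y \<in> W" "y \<notin> A" using assms(2,4) W_def by blast
  have step: "v \<in> A" if "u \<in> A" "v \<in> W" "{u, v} \<in> E'" for u v
    using assms(5) that by (auto simp: W_def E'_def adj_def)
  have closed: "is_path W E' xs \<Longrightarrow> hd xs \<in> A \<Longrightarrow> last xs \<in> A" for xs
  proof (induction xs rule: induct_list012)
    case (3 u v xs)
    then have "{u, v} \<in> E'" "v \<in> W" "is_path W E' (v # xs)" "u \<in> A" by (simp_all add: is_path_def)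
    then show ?case using "3.IH"(2) step[of u v] by simp
  qed (simp_all add: is_path_def)
  have "\<not> connected_graph W E'"
  proof
    assume "connected_graph W E'"
    moreover have "x \<in> W" using x assms(2) W_def by blast
    ultimately obtain xs where "is_path W E' xs" "hd xs = x" "last xs = y"
      using y(1) unfolding connected_graph_def by blast
    then show False using closed x y(2) by blast
  qed
  then show ?thesis using assms(1) by (simp add: separating_def W_def E'_def)
qed

lemma not_separating_complete:
  assumes "complete_graph V E"
  shows "\<not> separating V E S"
proof
  assume "separating V E S"
  then obtain A where A: "A \<subseteq> V - S" "A \<noteq> {}" "A \<noteq> V - S" "\<forall>a\<in>A. \<forall>b\<in>V - S - A. \<not> adj a b"
    by (rule separating_reachable)
  then obtain a b where ab: "a \<in> A" "b \<in> V - S - A" by blast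
  then have "\<not> adj a b" "a \<in> V" "b \<in> V" "a \<noteq> b" using A(1,4) by auto
  then show False using assms by (simp add: complete_graph_def adj_def)
qed

lemma finite_separating: "finite {card S | S. separating V E S}"
proof -
  have "{card S | S. separating V E S} \<subseteq> {..card V}"
    using finite_V by (auto simp: separating_def intro: card_mono)
  then show ?thesis by (rule finite_subset) simp
qed

lemma connectivity_le:
  assumes "separating V E S"
  shows "connectivity V E \<le> card S"
proof -
  have "Min {card S | S. separating V E S} \<le> card S"
    using assms finite_separating by (intro Min_le) auto
  then show ?thesis using assms not_separating_complete by (auto simp: connectivity_def)
qed

lemma min_separating:
  assumes "\<not> complete_graph V E"
  obtains S where "separating V E S" "card S = connectivity V E"
proof -
  obtain x y where xy: "x \<in> V" "y \<in> V" "x \<noteq> y" "\<not> adj x y"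
    using assms by (auto simp: complete_graph_def adj_def)
  \<comment> \<open>Removing everything but two nonadjacent vertices disconnects them, so the
    minimum is taken over a nonempty set.\<close>
  have "separating V E (V - {x, y})"
    using xy by (intro closed_imp_separating[of _ "{x}"]) auto
  then have "{card S | S. separating V E S} \<noteq> {}" by blast
  from Min_in[OF finite_separating this] show thesis
    using that assms by (auto simp: connectivity_def)
qed

lemma card_ge_3:
  assumes "2 \<le> connectivity V E"
  shows "3 \<le> card V"
proof (cases "complete_graph V E")
  case True
  then show ?thesis using assms by (simp add: connectivity_def)
next
  case False
  then obtain x y where xy: "x \<in> V" "y \<in> V" "x \<noteq> y" "\<not> adj x y"
    by (auto simp: complete_graph_def adj_def)
  have "separating V E (V - {x, y})"
    using xy by (intro closed_imp_separating[of _ "{x}"]) auto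
  then have "2 \<le> card (V - {x, y})" using connectivity_le assms by fastforce
  also have "\<dots> \<le> card V" using finite_V by (intro card_mono) auto
  finally show ?thesis using card_Diff_subset[of "{x, y}" V] xy finite_V \<open>2 \<le> card (V - {x, y})\<close> by auto
qed

text \<open>The triple itself makes the independence number at least 3, so \<open>sigma3\<close> is
  the minimum, with the triple among the competitors.\<close>

lemma sigma3_le:
  assumes "x \<in> V" "y \<in> V" "z \<in> V" "x \<noteq> y" "y \<noteq> z" "x \<noteq> z" "\<not> adj x y" "\<not> adj y z" "\<not> adj x z"
  shows "sigma3 V E \<le> enat (card (nbrs x) + card (nbrs y) + card (nbrs z))"
proof -
  let ?T = "{x, y, z}" and ?D = "{(\<Sum>x\<in>S. vertex_degree V E x) | S. independent_set V E S \<and> card S = 3}"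
  have deg: "vertex_degree V E v = card (nbrs v)" for v
    by (simp add: vertex_degree_def nbrs_def adj_def)
  have T: "independent_set V E ?T" "card ?T = 3"
    using assms adj_sym adj_irrefl by (auto simp: independent_set_def adj_def[symmetric])
  have fin: "finite (Pow V)" using finite_V by simp
  have "finite {S. independent_set V E S}"
    by (rule finite_subset[OF _ fin]) (auto simp: independent_set_def)
  then have f1: "finite {card S | S. independent_set V E S}" and f2: "finite ?D"
    by (auto intro: finite_subset[OF _ finite_imageI[of "{S. independent_set V E S}" "sum (vertex_degree V E)"]])
  have "3 \<le> independence_number V E"
    unfolding independence_number_def using T f1 by (intro Max_ge) (auto intro!: exI[of _ ?T])
  moreover have "Min ?D \<le> (\<Sum>x\<in>?T. vertex_degree V E x)" using T f2 by (intro Min_le) blast+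
  moreover have "(\<Sum>x\<in>?T. vertex_degree V E x) = card (nbrs x) + card (nbrs y) + card (nbrs z)"
    using assms by (simp add: deg)
  ultimately show ?thesis by (simp add: sigma3_def)
qed

lemma path_length_le: "path xs \<Longrightarrow> length xs \<le> card V"
  using finite_V card_mono[of V "set xs"] by (simp add: path_def distinct_card)

lemma finite_path_lengths: "finite {length xs | xs. is_path V E xs}"
proof (rule finite_subset)
  show "{length xs | xs. is_path V E xs} \<subseteq> {..card V}"
    using path_length_le path_iff by blast
qed simp

lemma finite_cycle_lengths: "finite {length xs | xs. is_cycle V E xs}"
proof (rule finite_subset[OF _ finite_path_lengths])
  show "{length xs | xs. is_cycle V E xs} \<subseteq> {length xs | xs. is_path V E xs}"
    unfolding is_cycle_def by blast
qed

end

section \<open>A cycle with one vertex fewer than a longest path\<close>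

text \<open>This is the situation to be refuted, with \<open>k\<close> standing for the
  connectivity. For empty \<open>S\<close>, \<open>two_connected\<close> expresses connectedness;
  for a singleton, the absence of a cut vertex.\<close>

locale short_cycles = sgraph +
  fixes p k :: nat
  assumes p_ge_3: "3 \<le> p"
    and k_ge_2: "2 \<le> k"
    and longest_path: "\<exists>xs. path xs \<and> length xs = p"
    and path_le: "path xs \<Longrightarrow> length xs \<le> p"
    and no_cycle: "cycle xs \<Longrightarrow> length xs \<noteq> p"
    and two_connected: "\<lbrakk>S \<subseteq> V; card S \<le> 1; A \<subseteq> V - S; A \<noteq> {}; A \<noteq> V - S\<rbrakk>
      \<Longrightarrow> \<exists>a\<in>A. \<exists>b\<in>V - S - A. adj a b"
    and degree_sum: "\<lbrakk>x \<in> V; y \<in> V; z \<in> V; x \<noteq> y; y \<noteq> z; x \<noteq> z; \<not> adj x y; \<not> adj y z; \<not> adj x z\<rbrakk>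
      \<Longrightarrow> p + k \<le> card (nbrs x) + card (nbrs y) + card (nbrs z)"
begin

lemma nbrs_hd_longest:
  assumes "path xs" "length xs = p"
  shows "nbrs (hd xs) \<subseteq> set xs"
proof
  fix y assume y: "y \<in> nbrs (hd xs)"
  show "y \<in> set xs"
  proof (rule ccontr)
    assume "y \<notin> set xs"
    then have "path (y # xs)" using assms y adj_V by (cases xs) (auto simp: path_Cons adj_sym)
    then show False using path_le[of "y # xs"] assms(2) by simp
  qed
qed

lemma not_adj_ends:
  assumes "path xs" "length xs = p"
  shows "\<not> adj (hd xs) (last xs)"
  using no_cycle[of xs] assms p_ge_3 by (auto simp: cycle_def adj_sym)

text \<open>The cycle \<open>I1 @ I2\<close> and the path \<open>M\<close>, whose ends are attached to the last vertices of
  \<open>I2\<close> and of \<open>I1\<close>.\<close>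

definition config :: "'a list \<Rightarrow> 'a list \<Rightarrow> 'a list \<Rightarrow> bool" where
  "config I1 I2 M \<longleftrightarrow> path I1 \<and> path I2 \<and> path M \<and>
    set I1 \<inter> set I2 = {} \<and> set I1 \<inter> set M = {} \<and> set I2 \<inter> set M = {} \<and>
    adj (last I1) (hd I2) \<and> adj (last I2) (hd I1) \<and>
    adj (last I2) (hd M) \<and> adj (last I1) (last M) \<and>
    length I1 + length I2 + length M = p"

lemma config_sym: "config I1 I2 M \<Longrightarrow> config I2 I1 (rev M)"
  by (auto simp: config_def hd_rev last_rev)

context
  fixes I1 I2 M
  assumes config: "config I1 I2 M"
begin

lemma config_ne: "I1 \<noteq> []" "I2 \<noteq> []" "M \<noteq> []"
  using config by (auto simp: config_def)

lemma config_len: "2 \<le> length I1 + length I2"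
  using config_ne by (cases I1; cases I2) auto

text \<open>The detour through \<open>M\<close> replaces both cycle edges between the arcs. So
  \<open>hd I1\<close> and \<open>hd I2\<close> are the ends of a longest path, which confines their
  neighbours (\<open>config_nbrs\<close>) and makes them nonadjacent
  (\<open>config_hd\<close>).\<close>

lemma config_longest1: "path (I2 @ M @ rev I1)" "length (I2 @ M @ rev I1) = p"
  using config config_ne by (auto simp: config_def path_append hd_rev adj_sym)

lemma config_longest2: "path (M @ rev I1 @ rev I2)" "length (M @ rev I1 @ rev I2) = p"
  using config config_ne by (auto simp: config_def path_append hd_rev last_rev adj_sym)

lemma config_nbrs:
  "nbrs (hd I1) \<subseteq> set I1 \<union> set I2 \<union> set M"
  "nbrs (hd I2) \<subseteq> set I1 \<union> set I2 \<union> set M"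
  "nbrs (hd M) \<subseteq> set I1 \<union> set I2 \<union> set M"
proof -
  have "path (rev (I2 @ M @ rev I1))" "length (rev (I2 @ M @ rev I1)) = p"
    using config_longest1 by (simp_all only: path_rev length_rev)
  from nbrs_hd_longest[OF this] show "nbrs (hd I1) \<subseteq> set I1 \<union> set I2 \<union> set M"
    using config_ne by auto
  show "nbrs (hd I2) \<subseteq> set I1 \<union> set I2 \<union> set M"
    using nbrs_hd_longest[OF config_longest1] config_ne by auto
  show "nbrs (hd M) \<subseteq> set I1 \<union> set I2 \<union> set M"
    using nbrs_hd_longest[OF config_longest2] config_ne by auto
qed

lemma config_hd: "\<not> adj (hd I1) (hd I2)"
  using not_adj_ends[OF config_longest1] config_ne by (simp add: last_rev adj_sym)

text \<open>The two chords would close \<open>a @ I2 @ M @ rev b\<close> to a cycle of order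
  \<open>p\<close>.\<close>

lemma config_crossing:
  assumes "I1 = a @ b" "a \<noteq> []" "b \<noteq> []" "adj (hd I1) (hd b)" "adj (hd I2) (last a)"
  shows False
proof -
  have "cycle (a @ I2 @ M @ rev b)"
    using config config_ne assms p_ge_3
    by (auto simp: config_def cycle_def path_simps)
  from no_cycle[OF this] show False using config assms(1) by (simp add: config_def)
qed

text \<open>Here the cycle of order \<open>p\<close> enters \<open>M\<close> from
  \<open>last a\<close> and runs back along \<open>I1\<close>, reaching \<open>last I2\<close> from
  \<open>hd I1\<close>.\<close>

lemma config_crossing_M:
  assumes "I2 = a @ b" "a \<noteq> []" "b \<noteq> []" "adj (hd I2) (hd b)" "adj (hd M) (last a)"
  shows False
proof -
  have "cycle (a @ M @ rev I1 @ rev b)"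
    using config config_ne assms p_ge_3
    by (auto simp: config_def cycle_def path_simps)
  from no_cycle[OF this] show False using config assms(1) by (simp add: config_def)
qed

end

text \<open>This is \<open>config\<close> before the cycle is cut into arcs, so that minimising over
  \<open>M\<close> leaves the cycle and the attachments free.\<close>

definition handle :: "'a list \<Rightarrow> 'a list \<Rightarrow> bool" where
  "handle C M \<longleftrightarrow> cycle C \<and> path M \<and> set C \<inter> set M = {} \<and> length C + length M = p \<and>
    (\<exists>v1\<in>set C. \<exists>v2\<in>set C. v1 \<noteq> v2 \<and> adj v1 (hd M) \<and> adj v2 (last M))"

lemma handle_config:
  assumes "handle C M"
  obtains I1 I2 where "config I1 I2 M"
proof -
  obtain v1 v2 where v: "v1 \<in> set C" "v2 \<in> set C" "v1 \<noteq> v2" "adj v1 (hd M)" "adj v2 (last M)"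
    using assms by (auto simp: handle_def)
  obtain L where L: "cycle L" "set L = set C" "length L = length C" "last L = v1"
    using cycle_last v(1) assms by (auto simp: handle_def)
  have "v2 \<in> set L" using L v by simp
  then obtain a b where "L = a @ v2 # b" by (auto dest: split_list)
  then obtain I1 where ab: "L = I1 @ b" "I1 \<noteq> []" "last I1 = v2" by (metis append_Cons append_Nil append_assoc last_snoc snoc_eq_iff_butlast)
  have "b \<noteq> []" using ab L(4) v(3) by auto
  then have "config I1 b M"
    using ab L v assms by (auto simp: config_def handle_def cycle_def path_simps)
  then show thesis by (rule that)
qed

lemma handleI:
  assumes "cycle C" "path M" "set C \<inter> set M = {}" "length C + length M = p"
    and "v1 \<in> set C" "v2 \<in> set C" "v1 \<noteq> v2" "adj v1 (hd M)" "adj v2 (last M)"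
  shows "handle C M"
  using assms by (auto simp: handle_def)

text \<open>A neighbour \<open>m\<close> of \<open>hd I1\<close> on \<open>M\<close> would let the
  cycle absorb \<open>M\<close> up to \<open>m\<close>. What remains of \<open>M\<close> is a
  shorter path attached at \<open>m\<close> and \<open>last I1\<close>, or is empty, and then the
  cycle has order \<open>p\<close>.\<close>

lemma no_handle_aux:
  assumes "config I1 I2 M"
    and no: "\<And>xs. cycle xs \<Longrightarrow> length xs + 1 \<noteq> p"
    and min: "\<And>C' M'. handle C' M' \<Longrightarrow> length M \<le> length M'"
  shows "nbrs (hd I1) \<inter> set M = {}"
proof (rule ccontr)
  note config = assms(1) and ne = config_ne[OF assms(1)]
  assume "\<not> ?thesis"
  then obtain m where m: "m \<in> set M" "adj (hd I1) m" by auto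
  then obtain a b where "M = a @ m # b" by (auto dest: split_list)
  then have "M = (a @ [m]) @ b" "last (a @ [m]) = m" "a @ [m] \<noteq> []" by simp_all
  then obtain a where M: "M = a @ b" "last a = m" "a \<noteq> []" by blast
  then have "1 \<le> length a" by (simp add: Suc_le_eq)
  then have c: "cycle (I1 @ I2 @ a)"
    using config ne config_len[OF config] m M
    by (cases "b = []") (auto simp: config_def cycle_def path_simps)
  show False
  proof (cases "b = []")
    case True
    then show False using no_cycle[OF c] config M by (simp add: config_def)
  next
    case False
    then have b: "path b" "adj m (hd b)" "set a \<inter> set b = {}" "last M = last b"
      using config M by (auto simp: config_def path_append)
    have "last I1 \<in> set I1" "m \<notin> set I1"  "m \<in> set a" using ne config m M by (auto simp: config_def)
    then have "handle (I1 @ I2 @ a) b"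
      using c b config M
      by (intro handleI[of _ _ m "last I1"]) (auto simp: config_def)
    from min[OF this] show False using M by simp
  qed
qed

lemma no_handle:
  assumes no: "\<And>xs. cycle xs \<Longrightarrow> length xs + 1 \<noteq> p"
  shows "\<not> handle C M"
proof
  assume "handle C M"
  then obtain M where "\<exists>C. handle C M" and least: "\<forall>M'. (\<exists>C'. handle C' M') \<longrightarrow> length M \<le> length M'"
    using ex_has_least_nat[of "\<lambda>M. \<exists>C. handle C M" M length] by blast
  from least have min: "length M \<le> length M'" if "handle C' M'" for C' M'
    using that by blast
  from \<open>\<exists>C. handle C M\<close> obtain C I1 I2 where C: "handle C M" and config: "config I1 I2 M"
    using handle_config by blast
  note ne = config_ne[OF config] and config' = config_sym[OF config]
  have d: "distinct I1" "distinct I2" "distinct M"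
    using config by (auto simp: config_def path_def)
  have min': "length (rev M) \<le> length M'" if "handle C' M'" for C' M'
    using min[OF that] by simp
  obtain h M' where M: "M = h # M'" using ne by (cases M) auto
  then have [simp]: "hd M = h" by simp
  have h: "h \<in> V" "h \<notin> set I1" "h \<notin> set I2"
    using config M by (auto simp: config_def path_def)
  let ?s1 = "hd I1" and ?s2 = "hd I2" and ?h = "h"
  have M': "M' \<noteq> []"
  proof
    assume "M' = []"
    then show False using no[of C] C M by (simp add: handle_def)
  qed
  text \<open>Since \<open>M\<close> is minimal, \<open>h\<close> cannot be moved from \<open>M\<close> to the cycle.\<close>
  have no_move: False if "cycle C'" "set C' = insert ?h (set I1 \<union> set I2)" "length C' = length I1 + length I2 + 1" for C'
  proof -
    have pM: "path M'" "adj ?h (hd M')" "?h \<notin> set M'" "last M = last M'"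
      using config M M' by (auto simp: config_def path_Cons)
    have "last I1 \<in> set I1" "?h \<notin> set I1" using ne config M by (auto simp: config_def)
    then have "handle C' M'"
      using that pM M config by (intro handleI[of _ _ ?h "last I1"]) (auto simp: config_def)
    from min[OF this] show False using M by simp
  qed
  have sM: "nbrs ?s1 \<inter> set M = {}" "nbrs ?s2 \<inter> set M = {}"
    using no_handle_aux[OF config no min] no_handle_aux[OF config' no min'] by simp_all
  \<comment> \<open>Each pattern excluded in \<open>card_consecutive3\<close> would yield a cycle of
    order \<open>p\<close>, a cycle that takes up just \<open>h\<close>, or, when \<open>t'\<close>
    is skipped, a cycle missing only \<open>t'\<close>, hence of order \<open>p - 1\<close>.\<close>
  have A: "card (nbrs ?s1 \<inter> set I1) + card (nbrs ?s2 \<inter> set I1) + card (nbrs ?h \<inter> set I1) \<le> length I1 + 1"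
  proof (rule card_consecutive3)
    fix a b assume I: "I1 = a @ b" "a \<noteq> []" "b \<noteq> []"
    show "last a \<notin> nbrs ?s2 \<union> nbrs ?h" if "hd b \<in> nbrs ?s1"
    proof -
      have "\<not> adj ?s2 (last a)" using config_crossing[OF config I] that by auto
      moreover have "\<not> adj ?h (last a)"
      proof
        assume "adj ?h (last a)"
        then have "cycle (a @ [?h] @ rev I2 @ rev b)"
          using config ne h p_ge_3 config_len[OF config] that I
          by (auto simp: config_def cycle_def path_simps)
        then show False by (rule no_move) (auto simp: I)
      qed
      ultimately show ?thesis by simp
    qed
    assume t: "last a \<in> nbrs ?s2 \<inter> nbrs ?h"
    show "hd b \<notin> nbrs ?s2 \<union> nbrs ?h"
    proof -
      have "\<not> adj ?h (hd b)"
      proof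
        assume "adj ?h (hd b)"
        then have "cycle (a @ [?h] @ b @ I2)"
          using config ne h p_ge_3 config_len[OF config] t I
          by (auto simp: config_def cycle_def path_simps)
        then show False by (rule no_move) (auto simp: I)
      qed
      moreover have "\<not> adj ?s2 (hd b)"
      proof
        assume "adj ?s2 (hd b)"
        then have "cycle (b @ rev M @ rev a @ rev I2)"
          using config ne h p_ge_3 config_len[OF config] t I
          by (auto simp: config_def cycle_def path_simps)
        from no_cycle[OF this] show False using config I by (simp add: config_def)
      qed
      ultimately show ?thesis by simp
    qed
  next
    fix a t' b assume I: "I1 = a @ t' # b" "a \<noteq> []" "b \<noteq> []" and t: "last a \<in> nbrs ?s2 \<inter> nbrs ?h"
    show "hd b \<notin> nbrs ?s1"
    proof
      have "1 \<le> length a" "1 \<le> length b" "1 \<le> length I2" using I ne by (simp_all add: Suc_le_eq)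
      moreover assume "hd b \<in> nbrs ?s1"
      ultimately have "cycle (a @ I2 @ M @ rev b)"
        using config ne h p_ge_3 config_len[OF config] t I
        by (auto simp: config_def cycle_def path_simps)
      from no[OF this] show False using config I by (simp add: config_def)
    qed
  qed (use d ne in auto)
  \<comment> \<open>The arcs do not play symmetric roles: \<open>h\<close> is attached to
    \<open>last I2\<close>, while \<open>last I1\<close> is joined to the other end of
    \<open>M\<close>. The exchanges therefore differ from those on \<open>I1\<close>.\<close>
  have B: "card (nbrs ?s2 \<inter> set I2) + card (nbrs ?s1 \<inter> set I2) + card (nbrs ?h \<inter> set I2) \<le> length I2 + 1"
  proof (rule card_consecutive3)
    fix a b assume I: "I2 = a @ b" "a \<noteq> []" "b \<noteq> []"
    show "last a \<notin> nbrs ?s1 \<union> nbrs ?h" if "hd b \<in> nbrs ?s2"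
      using config_crossing[OF config' I] config_crossing_M[OF config I] that by auto
    assume t: "last a \<in> nbrs ?s1 \<inter> nbrs ?h"
    show "hd b \<notin> nbrs ?s1 \<union> nbrs ?h"
    proof -
      have "\<not> adj ?h (hd b)"
      proof
        assume "adj ?h (hd b)"
        then have "cycle (I1 @ a @ [?h] @ b)"
          using config ne h p_ge_3 config_len[OF config] t I
          by (auto simp: config_def cycle_def path_simps)
        then show False by (rule no_move) (auto simp: I)
      qed
      moreover have "\<not> adj ?s1 (hd b)"
      proof
        assume "adj ?s1 (hd b)"
        then have "cycle (I1 @ a @ [?h] @ rev b)"
          using config ne h p_ge_3 config_len[OF config] t I
          by (auto simp: config_def cycle_def path_simps)
        then show False by (rule no_move) (auto simp: I)
      qed
      ultimately show ?thesis by simp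
    qed
  next
    fix a t' b assume I: "I2 = a @ t' # b" "a \<noteq> []" "b \<noteq> []" and t: "last a \<in> nbrs ?s1 \<inter> nbrs ?h"
    show "hd b \<notin> nbrs ?s2"
    proof
      have "1 \<le> length a" "1 \<le> length b" "1 \<le> length I1" using I ne by (simp_all add: Suc_le_eq)
      moreover assume "hd b \<in> nbrs ?s2"
      ultimately have "cycle (a @ I1 @ rev M @ rev b)"
        using config ne h p_ge_3 config_len[OF config] t I
        by (auto simp: config_def cycle_def path_simps)
      from no[OF this] show False using config I by (simp add: config_def)
    qed
  qed (use d ne in auto)
  have split: "card (nbrs v) \<le> card (nbrs v \<inter> set I1) + card (nbrs v \<inter> set I2) + card (nbrs v \<inter> set M)"
    if "nbrs v \<subseteq> set I1 \<union> set I2 \<union> set M" for v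
  proof -
    have "nbrs v = nbrs v \<inter> set I1 \<union> nbrs v \<inter> set I2 \<union> nbrs v \<inter> set M" using that by auto
    then show ?thesis
      by (metis (no_types, lifting) card_Un_le add_le_mono1 order_trans)
  qed
  have "nbrs ?h \<inter> set M \<subseteq> set M - {?h}" by auto
  then have "card (nbrs ?h \<inter> set M) \<le> length M - 1"
    using card_mono[of "set M - {?h}"] M d by (simp add: distinct_card)
  \<comment> \<open>Each arc contributes at most its length plus 1, and \<open>M\<close> only the at
    most \<open>length M - 1\<close> neighbours of \<open>h\<close>.\<close>
  then have "card (nbrs ?s1) + card (nbrs ?s2) + card (nbrs ?h) \<le> p + 1"
    using A B split[OF config_nbrs(1)[OF config]] split[OF config_nbrs(2)[OF config]]
      split[OF config_nbrs(3)[OF config]] sM config ne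
    by (simp add: config_def M)
  moreover have "p + k \<le> card (nbrs ?s1) + card (nbrs ?s2) + card (nbrs ?h)"
  proof (rule degree_sum)
    show "?s1 \<in> V" "?s2 \<in> V" "?h \<in> V" "?s1 \<noteq> ?s2" "?s2 \<noteq> ?h" "?s1 \<noteq> ?h"
      using config M hd_in_set[OF ne(1)] hd_in_set[OF ne(2)] path_subset[of I1] path_subset[of I2] path_subset[of M]
      unfolding config_def by auto
    show "\<not> adj ?s1 ?s2" by (rule config_hd[OF config])
    show "\<not> adj ?s2 ?h" "\<not> adj ?s1 ?h" using sM M by (auto simp: disjoint_iff)
  qed
  ultimately show False using k_ge_2 by simp
qed

text \<open>The two chords would close \<open>xs @ rev ys\<close> to a cycle to which
  \<open>m\<close> is attached at \<open>last xs\<close> and \<open>hd ys\<close>; for empty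
  \<open>m\<close> this cycle has order \<open>p\<close>.\<close>

lemma not_crossing:
  assumes no: "\<And>C M. \<not> handle C M"
    and P: "path (xs @ m @ ys)" "length (xs @ m @ ys) = p" "xs \<noteq> []" "ys \<noteq> []"
    and adj: "adj (hd xs) (hd ys)"
  shows "\<not> adj (last ys) (last xs)"
proof
  assume adj': "adj (last ys) (last xs)"
  have "3 \<le> length xs + length ys"
  proof (rule ccontr)
    assume "\<not> ?thesis"
    moreover have "1 \<le> length xs" "1 \<le> length ys" using P(3,4) by (simp_all add: Suc_le_eq)
    ultimately have "length xs = 1" "length ys = 1" by linarith+
    then obtain x y where "xs = [x]" "ys = [y]" by (auto simp: length_Suc_conv)
    then show False using not_adj_ends[OF P(1,2)] adj by simp
  qed
  then have c: "cycle (xs @ rev ys)"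
    using P adj adj' by (cases "m = []") (auto simp: cycle_def path_simps)
  show False
  proof (cases "m = []")
    case True
    then show False using no_cycle[OF c] P by simp
  next
    case False
    have "last xs \<noteq> hd ys"
      using P(1) hd_in_set[OF P(4)] last_in_set[OF P(3)] by (metis UnCI disjoint_iff distinct_append path_distinct set_append)
    then have "handle (xs @ rev ys) m"
      using c P False hd_in_set[OF P(4)] last_in_set[OF P(3)]
      by (intro handleI[of _ _ "last xs" "hd ys"]) (auto simp: path_simps)
    then show False using no by blast
  qed
qed

section \<open>Longest paths without crossing chords\<close>

lemma cycle_order:
  assumes no_cycle': "\<And>xs. cycle xs \<Longrightarrow> length xs + 1 \<noteq> p"
  shows False
proof -
  note no = no_handle[OF no_cycle']
  \<comment> \<open>\<open>K\<close> is an initial segment closed by the first vertex of the longest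
    path \<open>K @ T\<close>. Two vertices suffice for \<open>K\<close>, so any neighbour of the
    first vertex gives a lasso.\<close>
  define lasso where "lasso K T \<longleftrightarrow> path (K @ T) \<and> length (K @ T) = p \<and> K \<noteq> [] \<and> adj (hd K) (last K)" for K T
  obtain xs where xs: "path xs" "length xs = p" using longest_path by blast
  then have x: "xs \<noteq> []" "hd xs \<in> V" by (auto simp: path_def)
  have "{hd xs} \<noteq> V"
  proof
    assume "{hd xs} = V"
    then have "set xs \<subseteq> {hd xs}" using path_subset[OF xs(1)] by simp
    then have "card (set xs) \<le> 1" using card_mono[of "{hd xs}"] by fastforce
    then show False using xs distinct_card[OF path_distinct[OF xs(1)]] p_ge_3 by simp
  qed
  then obtain v where v: "adj (hd xs) v" using two_connected[of "{}" "{hd xs}"] x by auto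
  then have "v \<in> set xs" using nbrs_hd_longest[OF xs] by auto
  then obtain a b where "xs = a @ v # b" by (auto dest: split_list)
  then have "lasso (a @ [v]) b" using xs v by (cases a) (auto simp: lasso_def)
  then have "\<exists>T. lasso (a @ [v]) T" by blast
  moreover have "\<forall>K. (\<exists>T. lasso K T) \<longrightarrow> length K < Suc p" by (auto simp: lasso_def)
  ultimately have "\<exists>K. (\<exists>T. lasso K T) \<and> (\<forall>K'. (\<exists>T. lasso K' T) \<longrightarrow> length K' \<le> length K)"
    by (rule ex_has_greatest_nat[of "\<lambda>K. \<exists>T. lasso K T" "a @ [v]" length "Suc p"])
  then obtain K T where KT: "lasso K T" and "\<forall>K'. (\<exists>T. lasso K' T) \<longrightarrow> length K' \<le> length K"
    by (elim exE conjE)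
  then have max: "length K' \<le> length K" if "lasso K' T'" for K' T'
    using that by blast
  define r where "r = last K"
  have K: "path (K @ T)" "length K + length T = p" "K \<noteq> []" "adj (hd K) r"
    using KT by (auto simp: lasso_def r_def)
  have T: "T \<noteq> []"
  proof
    assume "T = []"
    then show False using not_adj_ends[of K] K by (simp add: r_def)
  qed
  have pK: "path K" "path T" "set K \<inter> set T = {}" "adj r (hd T)"
    using K T by (auto simp: path_append r_def)
  define w where "w = last T"
  have w: "w \<in> set T" "w \<in> V" "w \<notin> set K" using T pK by (auto simp: w_def path_def)
  have cK: "card (set K) = length K" using pK by (simp add: path_def distinct_card)
  \<comment> \<open>Any such \<open>Q\<close> may replace \<open>K\<close> in front of
    \<open>T\<close> and gives another longest path.\<close>
  define ham where "ham = (\<lambda>Q. path Q \<and> set Q = set K \<and> last Q = r)"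
  define F where "F = hd ` {Q. ham Q}"
  have ham_K: "ham K" using pK by (simp add: ham_def r_def)
  have ham_len: "length Q = length K" if "ham Q" for Q
    using that cK distinct_card[of Q] by (simp add: ham_def path_def)
  have ham_ne: "Q \<noteq> []" if "ham Q" for Q
    using that by (auto simp: ham_def)
  have F_iff: "e \<in> F \<longleftrightarrow> (\<exists>Q. ham Q \<and> hd Q = e)" for e
    by (auto simp: F_def)
  have "hd Q \<in> set K" if "ham Q" for Q
    using hd_in_set[OF ham_ne[OF that]] that by (simp add: ham_def)
  then have F_sub: "F \<subseteq> set K" by (auto simp: F_def)

  \<comment> \<open>A neighbour on \<open>T\<close> would close a longer initial segment of
    \<open>Q @ T\<close>, against the choice of \<open>K\<close>.\<close>
  have nbrs_ham: "nbrs (hd Q) \<subseteq> set K" if Q: "ham Q" for Q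
  proof
    fix t assume t: "t \<in> nbrs (hd Q)"
    have QT: "path (Q @ T)" "length (Q @ T) = p"
      using Q pK T K ham_ne[OF Q] ham_len[OF Q] by (auto simp: ham_def path_append)
    show "t \<in> set K"
    proof (rule ccontr)
      assume "t \<notin> set K"
      then have "t \<in> set T" using nbrs_hd_longest[OF QT] t ham_ne[OF Q] Q by (auto simp: ham_def)
      then obtain a b where "T = a @ t # b" by (auto dest: split_list)
      then have "lasso (Q @ a @ [t]) b" using QT t ham_ne[OF Q] by (simp add: lasso_def)
      from max[OF this] show False using ham_len[OF Q] by simp
    qed
  qed
  have nbrs_F: "nbrs e \<subseteq> set K" if "e \<in> F" for e
    using that nbrs_ham by (auto simp: F_def)

  have "nbrs w \<subseteq> insert r (set T - {w})"
  proof
    fix t assume t: "t \<in> nbrs w"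
    have "path (rev (K @ T))" "length (rev (K @ T)) = p" using K by (simp_all only: path_rev length_rev length_append)
    then have "t \<in> set (K @ T)" using nbrs_hd_longest[of "rev (K @ T)"] t T by (auto simp: w_def hd_append hd_rev)
    \<comment> \<open>A chord from \<open>w\<close> to another vertex of \<open>K\<close> would
      cross the chord from \<open>hd K\<close> to \<open>r\<close>.\<close>
    moreover have "t = r" if "t \<in> set K"
    proof (rule ccontr)
      assume "t \<noteq> r"
      obtain a b where ab: "K = a @ t # b" using \<open>t \<in> set K\<close> by (auto dest: split_list)
      then have "b \<noteq> []" "last b = r" using \<open>t \<noteq> r\<close> by (auto simp: r_def split: if_splits)
      then have "K @ T = (a @ [t]) @ butlast b @ (r # T)"
        using ab append_butlast_last_id[of b] by simp
      moreover have "adj (hd (a @ [t])) r" using K(4) ab by (cases a) auto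
      ultimately have "\<not> adj (last (r # T)) (last (a @ [t]))"
        using K by (intro not_crossing[OF no, of "a @ [t]" "butlast b" "r # T"]) auto
      then show False using t T by (simp add: w_def)
    qed
    moreover have "t \<noteq> w" using t by auto
    ultimately show "t \<in> insert r (set T - {w})" by auto
  qed
  then have "card (nbrs w) \<le> card (insert r (set T - {w}))" by (intro card_mono) auto
  also have "\<dots> \<le> Suc (card (set T - {w}))" by (simp add: card_insert_if)
  also have "\<dots> = length T" using w pK T by (simp add: path_def distinct_card)
  finally have deg_w: "card (nbrs w) \<le> length T" .

  \<comment> \<open>The third vertex of the triple is \<open>w\<close>, whose degree is at most
    \<open>length T\<close>, that is, \<open>p - length K\<close>.\<close>
  have deg_F: "length K + 2 \<le> card (nbrs e) + card (nbrs f)"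
    if "e \<in> F" "f \<in> F" "e \<noteq> f" "\<not> adj e f" for e f
  proof -
    have "\<not> adj e w" "\<not> adj f w" using nbrs_F[OF that(1)] nbrs_F[OF that(2)] w by auto
    moreover have "e \<in> V" "f \<in> V" "e \<noteq> w" "f \<noteq> w" using F_sub that w pK(1) by (auto simp: path_def)
    ultimately have "p + k \<le> card (nbrs e) + card (nbrs f) + card (nbrs w)"
      using that w by (intro degree_sum) auto
    then show ?thesis using deg_w K(2) k_ge_2 by simp
  qed

  \<comment> \<open>If \<open>hd a\<close> and \<open>hd b\<close> are adjacent, reversing
    \<open>a\<close> suffices. Otherwise both are in \<open>F\<close>, and their degree sum lets
    \<open>join_paths\<close> connect \<open>rev b\<close> and \<open>a\<close> to a path from
    \<open>r\<close> to \<open>last a\<close>.\<close>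
  have shift: "last a \<in> F" if "ham (a @ b)" "a \<noteq> []" "b \<noteq> []" "hd b \<in> F \<or> adj (hd a) (hd b)" for a b
  proof -
    have ab: "path a" "path b" "set a \<inter> set b = {}" "set a \<union> set b = set K" "last b = r"
      using that by (auto simp: ham_def path_append)
    have "\<exists>Q. ham Q \<and> hd Q = last a"
    proof (cases "adj (hd a) (hd b)")
      case True
      then have "ham (rev a @ b)" using ab that by (auto simp: ham_def path_simps)
      then show ?thesis using that by (metis hd_append2 hd_rev rev_is_Nil_conv)
    next
      case False
      have hdF: "hd a \<in> F" using that(1,2) by (auto simp: F_iff intro!: exI[of _ "a @ b"])
      have "hd a \<noteq> hd b" using ab(3) hd_in_set[OF that(2)] hd_in_set[OF that(3)] by auto
      then have "length K + 2 \<le> card (nbrs (hd a)) + card (nbrs (hd b))"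
        using deg_F hdF that(4) False by blast
      moreover have "nbrs (hd a) \<inter> set K = nbrs (hd a)" "nbrs (hd b) \<inter> set K = nbrs (hd b)"
        using nbrs_F hdF that(4) False by blast+
      moreover have "set b \<union> set a = set K" using ab by auto
      ultimately have "length (rev b) + length a + 1 \<le> card (nbrs (last (rev b)) \<inter> (set (rev b) \<union> set a))
          + card (nbrs (hd a) \<inter> (set (rev b) \<union> set a))"
        using ham_len[OF that(1)] that(3) by (simp add: last_rev)
      then obtain zs where "path zs" "set zs = set (rev b) \<union> set a" "hd zs = hd (rev b)" "last zs = last a"
        using join_paths[of "rev b" a] ab by (auto simp: Int_commute)
      then have "ham (rev zs)" "hd (rev zs) = last a"
        using ab that(3) by (auto simp: ham_def last_rev hd_rev)
      then show ?thesis by blast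
    qed
    then show ?thesis by (simp add: F_iff)
  qed

  have r_F: "r \<notin> F"
  proof
    assume "r \<in> F"
    then obtain Q where Q: "ham Q" "hd Q = last Q" by (auto simp: F_def ham_def)
    then have "Q = [r]" using ham_ne[OF Q(1)]
      by (cases Q) (auto simp: ham_def path_def split: if_splits)
    then have "set K = {r}" using Q by (simp add: ham_def)
    then show False using K(3,4) hd_in_set[OF K(3)] by auto
  qed

  have initial: "\<exists>Fs y rest. Q = Fs @ y # rest \<and> set Fs = F" if Q: "ham Q" for Q
  proof -
    define Fs where "Fs = takeWhile (\<lambda>x. x \<in> F) Q"
    define D where "D = dropWhile (\<lambda>x. x \<in> F) Q"
    have QD: "Q = Fs @ D" by (simp add: Fs_def D_def)
    have "r \<in> set K" using K(3) by (simp add: r_def)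
    then have "r \<in> set Q" using Q by (simp add: ham_def)
    then have D: "D \<noteq> []" using r_F by (auto simp: D_def dropWhile_eq_Nil_conv)
    then have hd_D: "hd D \<notin> F" using hd_dropWhile[of "\<lambda>x. x \<in> F" Q] by (simp add: D_def)
    \<comment> \<open>By \<open>shift\<close>, the first vertex of \<open>F\<close> after a gap
      would put its predecessor into \<open>F\<close>.\<close>
    have "f \<notin> F" if f: "f \<in> set D" for f
    proof
      assume "f \<in> F"
      then have "\<exists>x\<in>set D. x \<in> F" using f by blast
      then obtain u f' v where u: "D = u @ f' # v" "f' \<in> F" "\<forall>x\<in>set u. x \<notin> F"
        by (rule split_list_first_propE)
      then have "u \<noteq> []" using hd_D by auto
      then have "last (Fs @ u) \<in> F" using shift[of "Fs @ u" "f' # v"] u Q QD by simp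
      then show False using u(3) \<open>u \<noteq> []\<close> by simp
    qed
    moreover have "set Fs \<subseteq> F" by (auto simp: Fs_def dest: set_takeWhileD)
    moreover have "F \<subseteq> set Q" using F_sub Q by (simp add: ham_def)
    ultimately have "set Fs = F" using QD by auto
    then show ?thesis using QD D by (metis list.exhaust)
  qed

  have nbrs_initial: "nbrs (hd Q) \<subseteq> insert y F" if Q: "ham Q" "Q = Fs @ y # rest" "set Fs = F" for Q Fs y rest
  proof
    fix t assume t: "t \<in> nbrs (hd Q)"
    have "Fs \<noteq> []" using Q by (auto simp: F_def)
    have "t \<in> set Q" using nbrs_ham[OF Q(1)] t Q by (auto simp: ham_def)
    moreover have False if rest: "t \<in> set rest"
    proof -
      obtain c d where cd: "rest = c @ t # d" using rest by (auto dest: split_list)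
      have "last (Fs @ y # c) \<in> F"
        using shift[of "Fs @ y # c" "t # d"] Q cd t \<open>Fs \<noteq> []\<close> by simp
      then have "last (y # c) \<in> set Fs" using Q by simp
      moreover have "last (y # c) \<in> set (y # c)" by (intro last_in_set) simp
      ultimately show False using Q(1,2) cd by (auto simp: ham_def path_def)
    qed
    ultimately show "t \<in> insert y F" using Q by auto
  qed

  obtain Fs y rest where dec: "K = Fs @ y # rest" "set Fs = F" using initial[OF ham_K] by blast
  have dK: "distinct K" using pK by (simp add: path_def)
  have "Fs \<noteq> []" using ham_K dec by (auto simp: F_def)
  have "y \<notin> F" using dec dK by auto

  \<comment> \<open>\<open>nbrs_initial\<close> speaks of the vertex that follows \<open>F\<close>
    on the path at hand. To obtain the fixed \<open>y\<close>, a Hamiltonian path of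
    \<open>K\<close> from \<open>e\<close> is needed on which \<open>F\<close> is followed by this
    very \<open>y\<close>.\<close>
  have closed: "nbrs e \<subseteq> insert y F" if e: "e \<in> F" for e
  proof -
    obtain a b' where ab: "Fs = a @ e # b'" using e dec by (metis split_list)
    show ?thesis
    proof (cases b')
      case Nil
      then have "adj e y" using pK(1) dec ab path_append[of "a @ [e]" "y # rest"] by simp
      obtain Q where Q: "ham Q" "hd Q = e" using e by (auto simp: F_def)
      obtain Fs' y' rest' where "Q = Fs' @ y' # rest'" "set Fs' = F" using initial[OF Q(1)] by blast
      then have "nbrs e \<subseteq> insert y' F" using nbrs_initial[OF Q(1)] Q(2) by blast
      moreover have "y \<in> nbrs e" using \<open>adj e y\<close> by simp
      ultimately show ?thesis using \<open>y \<notin> F\<close> by blast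
    next
      case (Cons f b)
      define A where "A = a @ [e]"
      define B where "B = f # b @ [y]"
      have KAB: "K = A @ B @ rest" using dec ab Cons by (simp add: A_def B_def)
      have A: "A \<noteq> []" "last A = e" and B: "B \<noteq> []" "hd B = f" "last B = y" by (auto simp: A_def B_def)
      have AB: "set A \<union> set B = insert y F" using dec ab Cons by (auto simp: A_def B_def)
      have paths: "path A" "path B" "set A \<inter> set B = {}"
        using pK(1) KAB A(1) B(1) by (cases "rest = []"; auto simp: path_append)+
      have hdF: "hd A \<in> F" "f \<in> F" using dec ab Cons by (cases a; auto simp: A_def)+
      have "hd A \<noteq> f" using paths(3) hd_in_set[OF A(1)] hd_in_set[OF B(1)] B(2) by auto
      have nA: "nbrs (hd A) \<subseteq> insert y F" using nbrs_initial[OF ham_K dec] KAB A by simp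
      have "\<exists>zs. path zs \<and> set zs = insert y F \<and> hd zs = e \<and> last zs = y"
      proof (cases "adj (hd A) f")
        case True
        then have "path (rev A @ B)" using paths A B by (auto simp: path_simps)
        then show ?thesis using A B AB by (intro exI[of _ "rev A @ B"]) (auto simp: hd_rev)
      next
        case False
        \<comment> \<open>Ore's exchange is now carried out inside \<open>insert y F\<close>. At
          most one neighbour of \<open>f\<close>, namely \<open>y'\<close>, lies outside, and the
          surplus in \<open>length K + 2\<close> covers this loss.\<close>
        then have sum: "length K + 2 \<le> card (nbrs (hd A)) + card (nbrs f)"
          using deg_F hdF \<open>hd A \<noteq> f\<close> by blast
        obtain Q where Q: "ham Q" "hd Q = f" using hdF by (auto simp: F_def)
        obtain Fs' y' rest' where "Q = Fs' @ y' # rest'" "set Fs' = F" using initial[OF Q(1)] by blast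
        then have "nbrs f \<subseteq> insert y' F" using nbrs_initial[OF Q(1)] Q(2) by blast
        then have "nbrs f \<subseteq> insert y' (nbrs f \<inter> insert y F)" by auto
        then have "card (nbrs f) \<le> card (insert y' (nbrs f \<inter> insert y F))" by (intro card_mono) auto
        also have "\<dots> \<le> Suc (card (nbrs f \<inter> insert y F))" by (simp add: card_insert_if)
        finally have "card (nbrs f) \<le> Suc (card (nbrs f \<inter> insert y F))" .
        moreover have "nbrs (hd A) \<inter> insert y F = nbrs (hd A)" using nA by auto
        moreover have "set B \<union> set A = insert y F" using AB by auto
        ultimately have deg: "length (rev B) + length A + 1 \<le> card (nbrs (last (rev B)) \<inter> (set (rev B) \<union> set A))
          + card (nbrs (hd A) \<inter> (set (rev B) \<union> set A))"
          using sum KAB B by (simp add: last_rev)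
        have "path (rev B)" "set (rev B) \<inter> set A = {}" using paths by auto
        then obtain zs where zs: "path zs" "set zs = set (rev B) \<union> set A" "hd zs = hd (rev B)" "last zs = last A"
          using join_paths[OF _ paths(1) _ deg] by metis
        then have "zs \<noteq> []" by auto
        then show ?thesis using zs A B AB
          by (intro exI[of _ "rev zs"]) (simp add: hd_rev last_rev Un_commute)
      qed
      then obtain zs where zs: "path zs" "set zs = insert y F" "hd zs = e" "last zs = y" by blast
      define Gs where "Gs = butlast zs"
      have Gs: "zs = Gs @ [y]" using zs append_butlast_last_id[of zs] by (cases "zs = []") (simp_all add: Gs_def)
      then have "set Gs = F" using zs \<open>y \<notin> F\<close> path_distinct[OF zs(1)] by auto
      have "path (zs @ rest) \<and> last (zs @ rest) = r"
      proof (cases "rest = []")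
        case True
        then show ?thesis using zs dec by (simp add: r_def)
      next
        case False
        then have "path rest" "adj y (hd rest)" "set (Fs @ [y]) \<inter> set rest = {}"
          using pK(1) dec path_append[of "Fs @ [y]" rest] by auto
        moreover have "zs \<noteq> []" using zs by auto
        ultimately show ?thesis using zs dec False by (auto simp: path_append r_def)
      qed
      then have "ham (Gs @ y # rest)" using zs dec Gs \<open>set Gs = F\<close> by (auto simp: ham_def)
      from nbrs_initial[OF this refl \<open>set Gs = F\<close>] show ?thesis
        using zs Gs by (cases Gs) auto
    qed
  qed

  have "y \<in> set K" using dec by simp
  then have "y \<in> V" using pK(1) by (auto simp: path_def)
  have "F \<subseteq> V - {y}" using F_sub \<open>y \<notin> F\<close> pK(1) by (auto simp: path_def)
  moreover have "F \<noteq> {}" using dec(2) \<open>Fs \<noteq> []\<close> by auto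
  moreover have "w \<notin> F" "w \<noteq> y" using w F_sub \<open>y \<in> set K\<close> by auto
  then have "F \<noteq> V - {y}" using w by blast
  \<comment> \<open>Otherwise \<open>y\<close> would separate \<open>F\<close> from
    \<open>w\<close>.\<close>
  ultimately obtain a b where "a \<in> F" "b \<in> V - {y} - F" "adj a b"
    using two_connected[of "{y}" F] \<open>y \<in> V\<close> by auto
  then show False using closed[of a] by auto
qed

section \<open>Separations of the graph\<close>

text \<open>The sides are unions of components of the graph without \<open>S\<close>. Keeping them
  symmetric allows each argument to be used for either side.\<close>

definition separation :: "'a set \<Rightarrow> 'a set \<Rightarrow> 'a set \<Rightarrow> bool" where
  "separation S H1 H2 \<longleftrightarrow> S \<union> H1 \<union> H2 \<subseteq> V \<and> V \<subseteq> S \<union> H1 \<union> H2 \<and> S \<inter> H1 = {} \<and> S \<inter> H2 = {} \<and> H1 \<inter> H2 = {} \<and>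
    card S \<le> k \<and> H1 \<noteq> {} \<and> H2 \<noteq> {} \<and> (\<forall>a\<in>H1. \<forall>b\<in>H2. \<not> adj a b)"

lemma separation_sym: "separation S H1 H2 \<Longrightarrow> separation S H2 H1"
  unfolding separation_def using adj_sym by blast

lemma separation_finite: "separation S H1 H2 \<Longrightarrow> finite S \<and> finite H1 \<and> finite H2"
  using finite_subset[OF _ finite_V, of "S \<union> H1 \<union> H2"] by (simp add: separation_def)

lemma separation_common_nbrs:
  assumes "separation S H1 H2" "x \<in> H1" "y \<in> H2"
  shows "nbrs x \<inter> nbrs y \<subseteq> S"
proof
  fix u assume "u \<in> nbrs x \<inter> nbrs y"
  then have "adj x u" "adj u y" "u \<in> V" using adj_V by (auto simp: adj_sym)
  then show "u \<in> S" using assms unfolding separation_def by blast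
qed

lemma separation_degree:
  assumes "separation S H1 H2" "w \<in> H2"
  shows "card (nbrs w) + 1 \<le> card H2 + k"
proof -
  have "nbrs w \<subseteq> (H2 - {w}) \<union> S"
  proof
    fix u assume "u \<in> nbrs w"
    then have "adj u w" "u \<noteq> w" "u \<in> V" using adj_V by (auto simp: adj_sym)
    then show "u \<in> (H2 - {w}) \<union> S" using assms unfolding separation_def by blast
  qed
  then have "card (nbrs w) \<le> card ((H2 - {w}) \<union> S)"
    using separation_finite[OF assms(1)] by (intro card_mono) auto
  also have "\<dots> \<le> card (H2 - {w}) + card S" by (rule card_Un_le)
  finally show ?thesis
    using assms separation_finite[OF assms(1)] card_Suc_Diff1[of H2 w] by (auto simp: separation_def)
qed

text \<open>Otherwise \<open>z\<close> could be inserted between the last vertex of one arc and the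
  head of the other, giving a cycle of order \<open>p\<close>.\<close>

lemma config_single:
  assumes "config I1 I2 [z]"
  shows "\<not> adj (hd I1) z" "\<not> adj (hd I2) z"
proof -
  have *: "\<not> adj (hd I1) z" if "config I1 I2 [z]" for I1 I2
  proof
    assume "adj (hd I1) z"
    then have "cycle (z # I1 @ I2)"
      using that config_ne[OF that] config_len[OF that] by (auto simp: config_def cycle_def path_simps)
    from no_cycle[OF this] show False using that by (simp add: config_def)
  qed
  show "\<not> adj (hd I1) z" "\<not> adj (hd I2) z"
    using *[OF assms] *[of I2 I1] config_sym[OF assms] by simp_all
qed

text \<open>In \<open>card_consecutive\<close> the correction at the head vanishes, as
  \<open>hd I1\<close> is not its own neighbour, and the one at the last vertex is absorbed by the
  \<open>+ 1\<close>.\<close>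

lemma config_count:
  assumes "config I1 I2 [z]"
    and "\<And>a b. I1 = a @ b \<Longrightarrow> a \<noteq> [] \<Longrightarrow> b \<noteq> [] \<Longrightarrow> adj (hd I1) (hd b) \<Longrightarrow> last a \<notin> B"
  shows "card (nbrs (hd I1) \<inter> set I1) + card (B \<inter> set I1) \<le> length I1"
proof -
  have "card (nbrs (hd I1) \<inter> set I1) + card (B \<inter> set I1) + 1
    \<le> length I1 + of_bool (hd I1 \<in> nbrs (hd I1)) + of_bool (last I1 \<in> B)"
    using assms config_ne[OF assms(1)] by (intro card_consecutive) (auto simp: config_def path_def)
  moreover have "of_bool (last I1 \<in> B) \<le> (1::nat)" by simp
  ultimately show ?thesis by simp
qed

section \<open>Vertices outside a cycle of order \<open>p - 1\<close>\<close>

context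
  fixes C
  assumes C: "cycle C" "length C + 1 = p"
begin

text \<open>An edge from an outside vertex adjacent to \<open>C\<close> to another outside vertex
  would extend the opened cycle to a path of order \<open>p + 1\<close>. So by connectedness every
  outside vertex is adjacent to \<open>C\<close>, and none to another.\<close>

lemma nbrs_out:
  assumes "z \<in> V" "z \<notin> set C"
  shows "nbrs z \<subseteq> set C"
proof -
  have key: False if h: "c \<in> set C" "r \<notin> set C" "y \<notin> set C" "adj c r" "adj r y" for c r y
  proof -
    obtain L where L: "cycle L" "set L = set C" "length L = length C" "last L = c"
      using cycle_last[OF C(1) h(1)] by blast
    have "r \<noteq> y" using h by auto
    moreover have "r \<in> V" "y \<in> V" using h adj_V by blast+
    moreover have "path L" "L \<noteq> []" using L(1) by (auto simp: cycle_def)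
    ultimately have "path (L @ [r, y])" using L(2,4) h by (simp add: path_append path_Cons)
    from path_le[OF this] show False using C L by simp
  qed
  define A where "A = set C \<union> {r \<in> V. \<exists>c\<in>set C. adj c r}"
  have "set C \<subseteq> V" "C \<noteq> []" using C by (auto simp: cycle_def path_def)
  have "A = V"
  proof (rule ccontr)
    assume "A \<noteq> V"
    moreover have "A \<subseteq> V" "A \<noteq> {}" using \<open>set C \<subseteq> V\<close> \<open>C \<noteq> []\<close> by (auto simp: A_def)
    ultimately obtain a b where ab: "a \<in> A" "b \<in> V" "b \<notin> A" "adj a b"
      using two_connected[of "{}" A] by auto
    then have "a \<notin> set C" "b \<notin> set C" by (auto simp: A_def)
    moreover obtain c where "c \<in> set C" "adj c a" using ab(1) \<open>a \<notin> set C\<close> by (auto simp: A_def)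
    ultimately show False using key ab(4) by blast
  qed
  then obtain c where "c \<in> set C" "adj c z" using assms by (auto simp: A_def)
  then show ?thesis using key[of c z] assms(2) by (intro subsetI) (simp, blast)
qed

lemma second_nbr:
  assumes "z \<in> V" "z \<notin> set C" "v \<in> nbrs z"
  obtains v' where "v' \<in> nbrs z" "v' \<noteq> v"
proof -
  have C3: "3 \<le> card (set C)" "set C \<subseteq> V" using C(1) by (auto simp: cycle_def path_def distinct_card)
  have "\<exists>u. u \<in> set C \<and> u \<noteq> v"
  proof (rule ccontr)
    assume "\<not> ?thesis"
    then have "card (set C) \<le> card {v}" by (intro card_mono) auto
    then show False using C3 by simp
  qed
  then obtain u where u: "u \<in> set C" "u \<noteq> v" by (elim exE conjE)
  have "adj z v" using assms(3) by simp
  then have "v \<in> V" "z \<noteq> v" using adj_V[of z v] by auto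
  moreover have "u \<in> V - {v}" "u \<notin> {z}" using u C3(2) assms(2) by auto
  then have "{z} \<noteq> V - {v}" by metis
  ultimately have "\<exists>a\<in>{z}. \<exists>b\<in>V - {v} - {z}. adj a b"
    using assms(1) by (intro two_connected) simp_all
  then obtain b where "adj z b" "b \<noteq> v" by blast
  then show thesis by (intro that[of b]) simp_all
qed

lemma split_config:
  assumes "cycle L" "set L = set C" "length L = length C" "L = I1 @ I2" "I1 \<noteq> []" "I2 \<noteq> []"
    and "z \<in> V" "z \<notin> set C" "adj z (last I1)" "adj z (last I2)"
  shows "config I1 I2 [z]"
proof -
  have "path I1" "path I2" "set I1 \<inter> set I2 = {}" "adj (last I1) (hd I2)" "adj (last I2) (hd I1)"
    using assms(1,4-6) by (auto simp: cycle_def path_append)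
  moreover have "set I1 \<union> set I2 = set C" "length I1 + length I2 = length C"
    using assms(2-4) by auto
  ultimately show ?thesis using assms(7-10) C(2) by (auto simp: config_def adj_sym)
qed

text \<open>Cutting the cycle after \<open>v1\<close> and after \<open>v2\<close> makes the
  successors of these vertices the heads of the arcs.\<close>

lemma pair_config:
  assumes z: "z \<in> V" "z \<notin> set C" and v: "v1 \<in> nbrs z" "v2 \<in> nbrs z" "v1 \<noteq> v2"
  obtains I1 I2 where "config I1 I2 [z]" "set I1 \<union> set I2 = set C" "hd I1 = next_in C v1" "hd I2 = next_in C v2"
proof -
  have vC: "v1 \<in> set C" "v2 \<in> set C" using nbrs_out[OF z] v by auto
  obtain L where L: "cycle L" "set L = set C" "length L = length C" "last L = v1" "hd L = next_in C v1"
    "\<forall>a b. L = a @ b \<longrightarrow> a \<noteq> [] \<longrightarrow> b \<noteq> [] \<longrightarrow> hd b = next_in C (last a)"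
    by (rule rotate_to[OF C(1) vC(1)])
  obtain a b where "L = a @ v2 # b" using vC(2) L(2) by (metis split_list)
  then have ab: "L = (a @ [v2]) @ b" by simp
  then have "b \<noteq> []" using L(4) v(3) by auto
  have "config (a @ [v2]) b [z]"
    using L(4) ab \<open>b \<noteq> []\<close> v by (intro split_config[OF L(1-3) ab _ _ z]) auto
  moreover have "hd (a @ [v2]) = next_in C v1" using L(5) ab by (simp add: hd_append split: if_splits)
  moreover have "hd b = next_in C v2" using L(6) ab \<open>b \<noteq> []\<close> by (metis last_snoc snoc_eq_iff_butlast)
  ultimately show thesis using that[of "a @ [v2]" b] L(2) ab by auto
qed

text \<open>\<open>v2\<close> is the first neighbour of \<open>z\<close> met after
  \<open>v1\<close>, which leaves \<open>z\<close> no other neighbour on \<open>I1\<close>.\<close>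

lemma next_config:
  assumes z: "z \<in> V" "z \<notin> set C" and v1: "v1 \<in> nbrs z"
  obtains v2 I1 I2 where "config I1 I2 [z]" "set I1 \<union> set I2 = set C" "hd I1 = next_in C v1" "hd I2 = next_in C v2"
    "v2 \<in> nbrs z" "v2 \<noteq> v1" "last I2 = v1" "set I1 \<inter> nbrs z = {v2}"
proof -
  have v1C: "v1 \<in> set C" using nbrs_out[OF z] v1 by auto
  obtain L where L: "cycle L" "set L = set C" "length L = length C" "last L = v1" "hd L = next_in C v1"
    "\<forall>a b. L = a @ b \<longrightarrow> a \<noteq> [] \<longrightarrow> b \<noteq> [] \<longrightarrow> hd b = next_in C (last a)"
    by (rule rotate_to[OF C(1) v1C])
  obtain v' where v': "v' \<in> nbrs z" "v' \<noteq> v1" using second_nbr[OF z v1] by blast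
  have "\<exists>x\<in>set L. x \<in> nbrs z" using v1 v1C L(2) by blast
  then obtain a v2 b where av: "L = a @ v2 # b" "v2 \<in> nbrs z" "\<forall>x\<in>set a. x \<notin> nbrs z"
    by (rule split_list_first_propE)
  then have ab: "L = (a @ [v2]) @ b" by simp
  have dL: "distinct L" using L(1) by (simp add: cycle_def path_def)
  have "b \<noteq> []"
  proof
    assume "b = []"
    then have "v2 = v1" using L(4) ab by simp
    moreover have "v' \<in> set L" using nbrs_out[OF z] v'(1) L(2) by auto
    ultimately show False using ab \<open>b = []\<close> v' av(3) by auto
  qed
  then have "last b = v1" using L(4) ab by simp
  then have "v1 \<in> set b" using \<open>b \<noteq> []\<close> by auto
  then have "v2 \<noteq> v1" using dL ab by auto
  have "config (a @ [v2]) b [z]"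
    using \<open>last b = v1\<close> \<open>b \<noteq> []\<close> v1 av by (intro split_config[OF L(1-3) ab _ _ z]) auto
  moreover have "hd (a @ [v2]) = next_in C v1" using L(5) ab by (simp add: hd_append split: if_splits)
  moreover have "hd b = next_in C v2" using L(6) ab \<open>b \<noteq> []\<close> by (metis last_snoc snoc_eq_iff_butlast)
  moreover have "set (a @ [v2]) \<inter> nbrs z = {v2}" using av by auto
  ultimately show thesis
    using that[of "a @ [v2]" b v2] L(2) ab \<open>last b = v1\<close> \<open>v2 \<noteq> v1\<close> av(2) by auto
qed

context
  fixes z
  assumes z: "z \<in> V" "z \<notin> set C"
begin

lemma nbrs_z: "nbrs z \<subseteq> set C"
  by (rule nbrs_out[OF z])

lemma ex_nbr: "\<exists>v. v \<in> nbrs z"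
proof -
  have "set C \<subseteq> V" "C \<noteq> []" using C by (auto simp: cycle_def path_def)
  then have "{z} \<noteq> V" using z by (metis hd_in_set singletonD subsetD)
  then show ?thesis using two_connected[of "{}" "{z}"] z by auto
qed

text \<open>By \<open>config_single\<close> and \<open>config_hd\<close>, \<open>z\<close> and the
  successors of its neighbours together are independent, and \<open>config_nbrs\<close> keeps the
  neighbours of a successor on \<open>C\<close>.\<close>

lemma next_facts:
  assumes "v \<in> nbrs z"
  shows "adj v (next_in C v)" "\<not> adj z (next_in C v)" "next_in C v \<in> set C" "next_in C v \<in> V"
    "nbrs (next_in C v) \<subseteq> set C - next_in C ` nbrs z"
proof -
  obtain v2 I1 I2 where c: "config I1 I2 [z]" "set I1 \<union> set I2 = set C" "hd I1 = next_in C v" "last I2 = v"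
    by (rule next_config[OF z assms])
  show "adj v (next_in C v)" using c by (auto simp: config_def)
  show "\<not> adj z (next_in C v)" using config_single(1)[OF c(1)] c(3) by (simp add: adj_sym)
  show "next_in C v \<in> set C" using c(2,3) hd_in_set[of I1] config_ne[OF c(1)] by auto
  then show "next_in C v \<in> V" using C by (auto simp: cycle_def path_def)
  have "nbrs (next_in C v) \<subseteq> set C"
    using config_nbrs(1)[OF c(1)] config_single(1)[OF c(1)] c(2,3) by auto
  moreover have "\<not> adj (next_in C v) (next_in C v')" if v': "v' \<in> nbrs z" for v'
  proof (cases "v' = v")
    case False
    then obtain J1 J2 where "config J1 J2 [z]" "hd J1 = next_in C v" "hd J2 = next_in C v'"
      using pair_config[OF z assms v'] False by metis
    then show ?thesis using config_hd by metis
  qed simp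
  ultimately show "nbrs (next_in C v) \<subseteq> set C - next_in C ` nbrs z" by auto
qed

lemma card_next: "card (next_in C ` nbrs z) = card (nbrs z)"
  using inj_on_subset[OF inj_on_next_in nbrs_z] C by (intro card_image) (auto simp: cycle_def path_def)

text \<open>The two arc counts bound the degree sum of \<open>z\<close> and the successors of
  \<open>v1\<close> and \<open>v2\<close> by \<open>p - 1\<close> plus the vertices that the unions
  count only once. On \<open>I1\<close> these are at most \<open>v2\<close>, so
  \<open>degree_sum\<close> forces \<open>k\<close> of them on \<open>I2\<close>.\<close>

lemma common_with_next:
  assumes "v1 \<in> nbrs z"
  obtains v2 where "v2 \<in> nbrs z" "v2 \<noteq> v1" "k \<le> card (nbrs (next_in C v1) \<inter> nbrs z - {v2})"
proof -
  obtain v2 I1 I2 where c: "config I1 I2 [z]" "set I1 \<union> set I2 = set C" "hd I1 = next_in C v1" "hd I2 = next_in C v2"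
    and v2: "v2 \<in> nbrs z" "v2 \<noteq> v1" "set I1 \<inter> nbrs z = {v2}"
    using next_config[OF z assms] by metis
  note c' = config_sym[OF c(1), simplified]
  have I: "set I1 \<inter> set I2 = {}" "length I1 + length I2 + 1 = p" using c(1) by (auto simp: config_def)
  let ?X = "nbrs (next_in C v1)" and ?Y = "nbrs (next_in C v2)" and ?Z = "nbrs z"
  have A: "card (?X \<inter> set I1) + card ((?Y \<union> ?Z) \<inter> set I1) \<le> length I1"
    unfolding c(3,4)[symmetric]
  proof (rule config_count[OF c(1)])
    fix a b assume h: "I1 = a @ b" "a \<noteq> []" "b \<noteq> []" "adj (hd I1) (hd b)"
    show "last a \<notin> nbrs (hd I2) \<union> ?Z"
      using config_crossing[OF c(1) h] config_crossing_M[OF c' h] by auto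
  qed
  have B: "card (?Y \<inter> set I2) + card ((?X \<union> ?Z) \<inter> set I2) \<le> length I2"
    unfolding c(3,4)[symmetric]
  proof (rule config_count[OF c'])
    fix a b assume h: "I2 = a @ b" "a \<noteq> []" "b \<noteq> []" "adj (hd I2) (hd b)"
    show "last a \<notin> nbrs (hd I1) \<union> ?Z"
      using config_crossing[OF c' h] config_crossing_M[OF c(1) h] by auto
  qed
  have un: "card ((P \<union> Q) \<inter> set I) + card (P \<inter> Q \<inter> set I) = card (P \<inter> set I) + card (Q \<inter> set I)" for P Q :: "'a set" and I
  proof -
    have "(P \<union> Q) \<inter> set I = (P \<inter> set I) \<union> (Q \<inter> set I)" "P \<inter> Q \<inter> set I = (P \<inter> set I) \<inter> (Q \<inter> set I)" by auto
    then show ?thesis using card_Un_Int[of "P \<inter> set I" "Q \<inter> set I"] by simp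
  qed
  have split: "card P = card (P \<inter> set I1) + card (P \<inter> set I2)" if "P \<subseteq> set C" for P
  proof -
    have "card P = card ((P \<inter> set I1) \<union> (P \<inter> set I2))"
      using that c(2) by (intro arg_cong[of _ _ card]) auto
    also have "\<dots> = card (P \<inter> set I1) + card (P \<inter> set I2)"
      using I(1) by (intro card_Un_disjoint) auto
    finally show ?thesis .
  qed
  note f1 = next_facts[OF assms] and f2 = next_facts[OF v2(1)]
  have "?Y \<inter> ?Z \<inter> set I1 \<subseteq> {v2}" using v2(3) by blast
  then have "card (?Y \<inter> ?Z \<inter> set I1) \<le> 1" using card_mono[of "{v2}" "?Y \<inter> ?Z \<inter> set I1"] by simp
  moreover have "card (?X \<inter> ?Z \<inter> set I2) \<le> card (?X \<inter> ?Z - {v2})"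
    using v2(3) I(1) by (intro card_mono) (simp, blast)
  moreover have "?X \<subseteq> set C" "?Y \<subseteq> set C"
    using f1(5) f2(5) by blast+
  note split[OF this(1)] split[OF this(2)] split[OF nbrs_z]
  moreover have "p + k \<le> card ?X + card ?Y + card ?Z"
  proof (rule degree_sum)
    show "next_in C v1 \<in> V" "next_in C v2 \<in> V" "z \<in> V" using f1(4) f2(4) z(1) by simp_all
    show "next_in C v1 \<noteq> next_in C v2"
    proof
      assume "next_in C v1 = next_in C v2"
      moreover have "inj_on (next_in C) (set C)" using C(1) by (intro inj_on_next_in) (simp add: cycle_def path_def)
      ultimately have "v1 = v2" using nbrs_z assms v2(1) by (meson inj_onD subsetD)
      then show False using v2(2) by simp
    qed
    show "next_in C v2 \<noteq> z" "next_in C v1 \<noteq> z" using f1(3) f2(3) z(2) by auto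
    show "\<not> adj (next_in C v1) (next_in C v2)" using config_hd[OF c(1)] c(3,4) by simp
    show "\<not> adj (next_in C v2) z" "\<not> adj (next_in C v1) z" using f1(2) f2(2) by (simp_all add: adj_sym)
  qed
  ultimately have "k \<le> card (?X \<inter> ?Z - {v2})"
    using A B un[of ?Y ?Z I1] un[of ?X ?Z I2] I(2) C(2) by linarith
  with v2(1,2) show thesis by (rule that)
qed

text \<open>The \<open>k\<close> common neighbours found above exclude \<open>v2\<close>, which is a
  further neighbour of \<open>z\<close>. Hence the successors are too many to fit into a
  cut.\<close>

lemma degree_out: "k + 1 \<le> card (nbrs z)"
proof -
  obtain v1 where "v1 \<in> nbrs z" using ex_nbr by blast
  then obtain v2 where v2: "v2 \<in> nbrs z" "k \<le> card (nbrs (next_in C v1) \<inter> nbrs z - {v2})"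
    by (rule common_with_next)
  have "card (nbrs (next_in C v1) \<inter> nbrs z - {v2}) \<le> card (nbrs z - {v2})" by (intro card_mono) auto
  then show ?thesis using v2 card_Suc_Diff1[of "nbrs z" v2] by simp
qed

section \<open>The position of \<open>z\<close> and of the successors relative to a cut\<close>

lemma next_outside:
  assumes "separation S H1 H2"
  obtains v where "v \<in> nbrs z" "next_in C v \<notin> S"
proof -
  have "\<not> next_in C ` nbrs z \<subseteq> S"
  proof
    assume "next_in C ` nbrs z \<subseteq> S"
    then have "card (nbrs z) \<le> card S"
      using card_mono[of S "next_in C ` nbrs z"] card_next separation_finite[OF assms] by simp
    then show False using degree_out assms by (simp add: separation_def)
  qed
  then show thesis using that by blast
qed

lemma card_diff_next:
  "card (set C - next_in C ` nbrs z) + card (nbrs z) + 1 = p"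
proof -
  have "next_in C ` nbrs z \<subseteq> set C" using next_facts(3) by auto
  moreover have "card (set C) + 1 = p" using C by (simp add: cycle_def path_def distinct_card)
  ultimately show ?thesis
    using card_next card_Diff_subset[of "next_in C ` nbrs z" "set C"] card_mono[of "set C" "next_in C ` nbrs z"] by simp
qed

text \<open>The two neighbourhoods lie in a set of \<open>p - 1 - card (nbrs z)\<close> vertices and
  meet only in \<open>S\<close>. With the degree of \<open>z\<close> the sum is at most
  \<open>p + k - 1\<close>.\<close>

lemma next_one_side:
  assumes sep: "separation S H1 H2" and v: "v1 \<in> nbrs z" "v2 \<in> nbrs z" "next_in C v1 \<in> H1" "next_in C v2 \<in> H2"
  shows False
proof -
  let ?X = "nbrs (next_in C v1)" and ?Y = "nbrs (next_in C v2)"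
  have "card (?X \<union> ?Y) \<le> card (set C - next_in C ` nbrs z)"
    using next_facts(5)[OF v(1)] next_facts(5)[OF v(2)] by (intro card_mono) auto
  moreover have "card (?X \<inter> ?Y) \<le> card S"
    using separation_common_nbrs[OF sep v(3,4)] separation_finite[OF sep] by (intro card_mono) auto
  moreover have "card S \<le> k" using sep by (simp add: separation_def)
  moreover have "p + k \<le> card ?X + card ?Y + card (nbrs z)"
  proof (rule degree_sum)
    show "next_in C v1 \<in> V" "next_in C v2 \<in> V" "z \<in> V" using next_facts(4) v z by auto
    show "next_in C v1 \<noteq> next_in C v2" "\<not> adj (next_in C v1) (next_in C v2)" using sep v by (auto simp: separation_def)
    show "next_in C v2 \<noteq> z" "next_in C v1 \<noteq> z" using next_facts(3) v z by auto
    show "\<not> adj (next_in C v2) z" "\<not> adj (next_in C v1) z" using next_facts(2) v by (simp_all add: adj_sym)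
  qed
  ultimately show False using card_Un_Int[of ?X ?Y, OF finite_nbrs finite_nbrs] card_diff_next by linarith
qed

text \<open>The \<open>k\<close> common neighbours of \<open>z\<close> and the successor of
  \<open>v1\<close> lie in \<open>S\<close>, hence fill it. So \<open>v2\<close> is outside
  \<open>S\<close>, and so is its successor, since \<open>S\<close> consists of neighbours of
  \<open>z\<close>. Both are then on the side of \<open>z\<close>, against
  \<open>next_one_side\<close>.\<close>

lemma next_same_side:
  assumes sep: "separation S H1 H2" and v: "v1 \<in> nbrs z" "next_in C v1 \<in> H1" and "z \<in> H2"
  shows False
proof -
  obtain v2 where v2: "v2 \<in> nbrs z" "k \<le> card (nbrs (next_in C v1) \<inter> nbrs z - {v2})"
    using common_with_next[OF v(1)] by blast
  have "nbrs (next_in C v1) \<inter> nbrs z - {v2} \<subseteq> S"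
    using separation_common_nbrs[OF sep v(2) \<open>z \<in> H2\<close>] by auto
  moreover have "finite S" "card S \<le> k" using sep separation_finite[OF sep] by (auto simp: separation_def)
  ultimately have S: "nbrs (next_in C v1) \<inter> nbrs z - {v2} = S"
    using v2(2) by (intro card_seteq) auto
  have "v2 \<notin> S" using S by auto
  moreover have "adj v2 z" "v2 \<in> V" using v2(1) adj_V[of z v2] by (auto simp: adj_sym)
  ultimately have "v2 \<in> H2" using sep \<open>z \<in> H2\<close> unfolding separation_def by blast
  have "next_in C v2 \<notin> S" using S next_facts(2)[OF v2(1)] by auto
  then have "next_in C v2 \<in> H2"
    using next_facts(1)[OF v2(1), unfolded adj_sym[of v2]] next_facts(4)[OF v2(1)] \<open>v2 \<in> H2\<close> sep
    unfolding separation_def by blast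
  then show False using next_one_side[OF sep v(1) v2(1) v(2)] by blast
qed

text \<open>The successor of \<open>v\<close> has at most
  \<open>p - 1 - card (nbrs z) - card H2\<close> neighbours and \<open>w\<close> at most
  \<open>card H2 + k - 1\<close>. With the degree of \<open>z\<close> this falls short of
  \<open>p + k\<close>.\<close>

lemma adj_other_side:
  assumes sep: "separation S H1 H2" and H2: "H2 \<subseteq> set C" "next_in C ` nbrs z \<inter> H2 = {}"
    and v: "v \<in> nbrs z" "next_in C v \<in> H1" and w: "w \<in> H2"
  shows "adj z w"
proof (rule ccontr)
  assume nadj: "\<not> adj z w"
  have "\<forall>u\<in>H2. \<not> adj (next_in C v) u" using sep v(2) by (simp add: separation_def)
  then have "nbrs (next_in C v) \<inter> H2 = {}" by auto
  then have "nbrs (next_in C v) \<subseteq> (set C - next_in C ` nbrs z) - H2"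
    using next_facts(5)[OF v(1)] by blast
  then have "card (nbrs (next_in C v)) \<le> card ((set C - next_in C ` nbrs z) - H2)" by (intro card_mono) auto
  moreover have "card ((set C - next_in C ` nbrs z) - H2) + card H2 = card (set C - next_in C ` nbrs z)"
  proof -
    have "H2 \<subseteq> set C - next_in C ` nbrs z" using H2 by auto
    then show ?thesis
      using card_Diff_subset[of H2 "set C - next_in C ` nbrs z"] card_mono[of "set C - next_in C ` nbrs z" H2]
        separation_finite[OF sep] by simp
  qed
  moreover have "p + k \<le> card (nbrs (next_in C v)) + card (nbrs w) + card (nbrs z)"
  proof (rule degree_sum)
    show "next_in C v \<in> V" "w \<in> V" "z \<in> V" using next_facts(4) v w z sep by (auto simp: separation_def)
    show "next_in C v \<noteq> w" "\<not> adj (next_in C v) w" using sep v w by (auto simp: separation_def)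
    show "w \<noteq> z" "next_in C v \<noteq> z" using next_facts(3) v z w H2 by auto
    show "\<not> adj w z" "\<not> adj (next_in C v) z" using next_facts(2) v nadj by (simp_all add: adj_sym)
  qed
  ultimately show False using card_diff_next separation_degree[OF sep w] by linarith
qed

text \<open>With \<open>C\<close> opened after \<open>v\<close>, crossing chords at the successor of
  \<open>v\<close> and an outside vertex give a cycle of order \<open>p\<close> or a path of order
  \<open>p + 1\<close>. So the degree of the successor plus the size of
  \<open>nbrs y \<union> nbrs z\<close> is at most \<open>p - 1\<close>, which forces a large
  intersection.\<close>

lemma two_out:
  assumes y: "y \<in> V" "y \<notin> set C" "y \<noteq> z"
  shows "k + 1 \<le> card (nbrs y \<inter> nbrs z)"
proof -
  obtain v where v: "v \<in> nbrs z" using ex_nbr by blast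
  then have "v \<in> set C" using nbrs_z by auto
  then obtain L where L: "cycle L" "set L = set C" "length L = length C" "last L = v" "hd L = next_in C v"
    using rotate_to[OF C(1)] by metis
  have pL: "path L" "L \<noteq> []" using L(1) by (auto simp: cycle_def)
  have nadj: "\<not> adj y (next_in C v)"
  proof
    assume "adj y (next_in C v)"
    then have "path ([y] @ L @ [z])" using pL L z y v by (auto simp: path_simps)
    from path_le[OF this] show False using L C by simp
  qed
  let ?B = "nbrs y \<union> nbrs z"
  have A: "card (nbrs (next_in C v) \<inter> set L) + card (?B \<inter> set L) + 1
    \<le> length L + of_bool (hd L \<in> nbrs (next_in C v)) + of_bool (last L \<in> ?B)"
  proof (rule card_consecutive)
    fix a b assume ab: "L = a @ b" "a \<noteq> []" "b \<noteq> []"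
    show "\<not> (hd b \<in> nbrs (next_in C v) \<and> last a \<in> ?B)"
    proof
      assume h: "hd b \<in> nbrs (next_in C v) \<and> last a \<in> ?B"
      have s: "hd a = next_in C v" "last b = v" using L ab by auto
      have "3 \<le> length a + length b" using L(1) ab by (simp add: cycle_def)
      show False
      proof (cases "adj z (last a)")
        case True
        then have "cycle (a @ [z] @ rev b)"
          using pL L(2) z v h s ab \<open>3 \<le> length a + length b\<close> by (auto simp: cycle_def path_simps)
        from no_cycle[OF this] show False using L(3) ab C by simp
      next
        case False
        then have "path ([y] @ rev a @ b @ [z])"
          using pL L(2) z y v h s ab by (auto simp: path_simps)
        from path_le[OF this] show False using L(3) ab C by simp
      qed
    qed
  qed (use pL path_distinct in auto)
  have e: "nbrs (next_in C v) \<inter> set L = nbrs (next_in C v)" "?B \<inter> set L = ?B"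
    using next_facts(5)[OF v] nbrs_z nbrs_out[OF y(1,2)] L(2) by auto
  have b: "of_bool (last L \<in> ?B) \<le> (1::nat)" "of_bool (hd L \<in> nbrs (next_in C v)) = (0::nat)"
    using L(5) by simp_all
  have "card (nbrs (next_in C v)) + card ?B \<le> length C"
    using A b L(3) unfolding e by linarith
  moreover have "p + k \<le> card (nbrs (next_in C v)) + card (nbrs y) + card (nbrs z)"
  proof (rule degree_sum)
    show "next_in C v \<in> V" "y \<in> V" "z \<in> V" using next_facts(4) v y z by auto
    show "next_in C v \<noteq> y" "next_in C v \<noteq> z" using next_facts(3)[OF v] y z by auto
    show "\<not> adj (next_in C v) y" "\<not> adj (next_in C v) z" using next_facts(2)[OF v] nadj by (simp_all add: adj_sym)
    show "y \<noteq> z" by fact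
    show "\<not> adj y z" using nbrs_z y(2) adj_sym nbrs_iff by blast
  qed
  ultimately show ?thesis
    using card_Un_Int[of "nbrs y" "nbrs z", OF finite_nbrs finite_nbrs] C(2) by linarith
qed

text \<open>Suppose \<open>z\<close> is in \<open>H1\<close>. A vertex of \<open>H2\<close> outside
  \<open>C\<close> would share more than \<open>k\<close> neighbours with \<open>z\<close>, all in
  \<open>S\<close>. So \<open>H2\<close> lies on \<open>C\<close>; it contains no successor, some
  successor is in \<open>H1\<close>, and \<open>adj_other_side\<close> yields an edge from
  \<open>z\<close> across the cut.\<close>

lemma out_in_cut:
  assumes sep: "separation S H1 H2"
  shows "z \<in> S"
proof -
  have "z \<notin> H1" if sep: "separation S H1 H2" for H1 H2
  proof
    assume "z \<in> H1"
    have "H2 \<subseteq> set C"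
    proof (rule ccontr)
      assume "\<not> ?thesis"
      then obtain y where y: "y \<in> H2" "y \<notin> set C" by auto
      then have "y \<in> V" "y \<noteq> z" using sep \<open>z \<in> H1\<close> by (auto simp: separation_def)
      then have "k + 1 \<le> card (nbrs y \<inter> nbrs z)" using y two_out by blast
      also have "\<dots> \<le> card S"
        using separation_common_nbrs[OF sep \<open>z \<in> H1\<close> y(1)] separation_finite[OF sep] by (intro card_mono) auto
      finally show False using sep by (simp add: separation_def)
    qed
    moreover have "next_in C ` nbrs z \<inter> H2 = {}"
      using next_same_side[OF separation_sym[OF sep] _ _ \<open>z \<in> H1\<close>] by auto
    moreover obtain v where v: "v \<in> nbrs z" "next_in C v \<notin> S" using next_outside[OF sep] by blast
    moreover have "next_in C v \<in> H1" using v calculation(2) next_facts(4) sep unfolding separation_def by blast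
    moreover obtain w where "w \<in> H2" using sep by (auto simp: separation_def)
    ultimately have "adj z w" using adj_other_side[OF sep] by blast
    then show False using sep \<open>z \<in> H1\<close> \<open>w \<in> H2\<close> by (auto simp: separation_def)
  qed
  from this[OF sep] this[OF separation_sym[OF sep]] show ?thesis
    using z sep by (auto simp: separation_def)
qed

text \<open>As \<open>z\<close> occupies a place in \<open>S\<close>, at most \<open>k - 1\<close>
  of its at least \<open>k + 1\<close> successors lie there. None is in \<open>H2\<close>, so two
  are in \<open>H1\<close>; they form the bad triple with a vertex of \<open>H2\<close>.\<close>

lemma cut_out_False:
  assumes sep: "separation S H1 H2" and out: "V - set C \<subseteq> S" and v: "v \<in> nbrs z" "next_in C v \<in> H1"
  shows False
proof -
  have "z \<in> S" using out z by auto
  have H2: "H2 \<subseteq> set C" using out sep by (auto simp: separation_def)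
  have nH2: "next_in C ` nbrs z \<inter> H2 = {}" using next_one_side[OF sep v(1) _ v(2)] by auto
  have adj_z: "adj z w" if "w \<in> H2" for w
    using adj_other_side[OF sep H2 nH2 v that] .
  have fin: "finite S" "finite H1" "finite H2" using separation_finite[OF sep] by auto
  have "next_in C ` nbrs z \<subseteq> (S - {z}) \<union> (next_in C ` nbrs z \<inter> H1)"
  proof
    fix u assume u: "u \<in> next_in C ` nbrs z"
    then have "u \<in> set C" "u \<in> V" using next_facts(3,4) by blast+
    then have "u \<noteq> z" "u \<in> S \<or> u \<in> H1 \<or> u \<in> H2" using z(2) sep by (auto simp: separation_def)
    then show "u \<in> (S - {z}) \<union> (next_in C ` nbrs z \<inter> H1)" using u nH2 by blast
  qed
  then have "card (next_in C ` nbrs z) \<le> card ((S - {z}) \<union> (next_in C ` nbrs z \<inter> H1))"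
    using fin by (intro card_mono) auto
  also have "\<dots> \<le> card (S - {z}) + card (next_in C ` nbrs z \<inter> H1)" by (rule card_Un_le)
  finally have "2 \<le> card (next_in C ` nbrs z \<inter> H1)"
    using card_next degree_out card_Suc_Diff1[of S z] fin \<open>z \<in> S\<close> sep by (auto simp: separation_def)
  then have "\<not> next_in C ` nbrs z \<inter> H1 \<subseteq> {next_in C v}" using card_mono[of "{next_in C v}" "next_in C ` nbrs z \<inter> H1"] by auto
  then obtain u where u: "u \<in> next_in C ` nbrs z" "u \<in> H1" "u \<noteq> next_in C v" by blast
  then obtain v' where "v' \<in> nbrs z" "u = next_in C v'" by blast
  with u have v': "v' \<in> nbrs z" "next_in C v' \<in> H1" "next_in C v' \<noteq> next_in C v" by simp_all
  then have "v \<noteq> v'" by auto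
  then obtain I1 I2 where c: "config I1 I2 [z]" "set I1 \<union> set I2 = set C" "hd I1 = next_in C v" "hd I2 = next_in C v'"
    using pair_config[OF z v(1) v'(1)] by metis
  note c' = config_sym[OF c(1), simplified]
  have I: "set I1 \<inter> set I2 = {}" "length I1 + length I2 + 1 = p" using c(1) by (auto simp: config_def)
  let ?X = "nbrs (next_in C v)" and ?Y = "nbrs (next_in C v')"
  \<comment> \<open>In both arc counts \<open>H2\<close> takes the place of \<open>nbrs z\<close>,
    which contains it. It is disjoint from both neighbourhoods, so the three sizes add up to at most
    \<open>p - 1\<close>, while a vertex of \<open>H2\<close> has degree at most
    \<open>card H2 + k - 1\<close>.\<close>
  have A: "card (?X \<inter> set I1) + card ((?Y \<union> H2) \<inter> set I1) \<le> length I1"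
    unfolding c(3,4)[symmetric]
  proof (rule config_count[OF c(1)])
    fix a b assume h: "I1 = a @ b" "a \<noteq> []" "b \<noteq> []" "adj (hd I1) (hd b)"
    show "last a \<notin> nbrs (hd I2) \<union> H2"
      using config_crossing[OF c(1) h] config_crossing_M[OF c' h] adj_z by auto
  qed
  have B: "card (?Y \<inter> set I2) + card ((?X \<union> H2) \<inter> set I2) \<le> length I2"
    unfolding c(3,4)[symmetric]
  proof (rule config_count[OF c'])
    fix a b assume h: "I2 = a @ b" "a \<noteq> []" "b \<noteq> []" "adj (hd I2) (hd b)"
    show "last a \<notin> nbrs (hd I1) \<union> H2"
      using config_crossing[OF c' h] config_crossing_M[OF c(1) h] adj_z by auto
  qed
  have un: "card ((P \<union> Q) \<inter> set I) = card (P \<inter> set I) + card (Q \<inter> set I)" if "P \<inter> Q = {}" for P Q :: "'a set" and I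
    unfolding Int_Un_distrib2 using that by (intro card_Un_disjoint) auto
  have disj: "?X \<inter> H2 = {}" "?Y \<inter> H2 = {}" using v v' sep by (auto simp: separation_def)
  have split: "card P = card (P \<inter> set I1) + card (P \<inter> set I2)" if "P \<subseteq> set C" for P
  proof -
    have "card P = card ((P \<inter> set I1) \<union> (P \<inter> set I2))"
      using that c(2) by (intro arg_cong[of _ _ card]) auto
    also have "\<dots> = card (P \<inter> set I1) + card (P \<inter> set I2)"
      using I(1) by (intro card_Un_disjoint) auto
    finally show ?thesis .
  qed
  have "?X \<subseteq> set C" "?Y \<subseteq> set C"
    using next_facts(5)[OF v(1)] next_facts(5)[OF v'(1)] by blast+
  note split[OF this(1)] split[OF this(2)] split[OF H2]
  moreover obtain w where w: "w \<in> H2" using sep by (auto simp: separation_def)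
  moreover have "p + k \<le> card ?X + card ?Y + card (nbrs w)"
  proof (rule degree_sum)
    show "next_in C v \<in> V" "next_in C v' \<in> V" "w \<in> V" using next_facts(4) v v' w sep by (auto simp: separation_def)
    show "next_in C v \<noteq> next_in C v'" using v' by simp
    show "\<not> adj (next_in C v) (next_in C v')" using config_hd[OF c(1)] c by simp
    show "next_in C v' \<noteq> w" "next_in C v \<noteq> w" "\<not> adj (next_in C v') w" "\<not> adj (next_in C v) w"
      using v v' w sep by (auto simp: separation_def)
  qed
  ultimately show False
    using A B un[OF disj(1), of I2] un[OF disj(2), of I1] I(2) separation_degree[OF sep w] by linarith
qed

end

end

lemma no_separation: "\<not> separation S H1 H2"
proof
  assume sep: "separation S H1 H2"
  have "\<exists>C. cycle C \<and> length C + 1 = p"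
  proof (rule ccontr)
    assume "\<not> ?thesis"
    then have "length xs + 1 \<noteq> p" if "cycle xs" for xs using that by blast
    then show False by (rule cycle_order)
  qed
  then obtain C where C: "cycle C" "length C + 1 = p" by blast
  obtain xs where xs: "path xs" "length xs = p" using longest_path by blast
  \<comment> \<open>A longest path has one vertex more than \<open>C\<close> and so supplies a
    vertex outside.\<close>
  have "\<not> set xs \<subseteq> set C"
  proof
    assume "set xs \<subseteq> set C"
    then have "card (set xs) \<le> card (set C)" by (intro card_mono) auto
    then show False using C xs by (simp add: cycle_def path_def distinct_card)
  qed
  then obtain z where "z \<in> set xs" and z: "z \<notin> set C" by blast
  then have zV: "z \<in> V" using path_subset[OF xs(1)] by blast
  have out: "V - set C \<subseteq> S"
  proof
    fix y assume "y \<in> V - set C"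
    then show "y \<in> S" by (intro out_in_cut[OF C _ _ sep]) simp_all
  qed
  obtain v where v: "v \<in> nbrs z" "next_in C v \<notin> S" by (rule next_outside[OF C zV z sep])
  then have "next_in C v \<in> H1 \<or> next_in C v \<in> H2"
    using next_facts(4)[OF C zV z v(1)] sep by (auto simp: separation_def)
  then show False
    using cut_out_False[OF C zV z sep out v(1)] cut_out_False[OF C zV z separation_sym[OF sep] out v(1)] by blast
qed

end

section \<open>The main theorem\<close>

theorem theorem3:
  fixes V :: "'a set" and E :: "'a set set" and n p c \<kappa> :: nat
  assumes "simple_graph V E"
    and "k_connected 2 V E"
    and "n = card V"
    and "p = longest_path_order V E"
    and "c = longest_cycle_order V E"
    and "\<kappa> = connectivity V E"
    and "1 / 3 * ereal_of_enat (sigma3 V E) \<ge> ereal ((real p + real \<kappa>) / 3)"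
  shows "c = p \<and> p = n \<and> hamiltonian V E"
proof -
  interpret sgraph V E using assms(1) by unfold_locales
  have \<kappa>: "2 \<le> \<kappa>" using assms(2,6) by (simp add: k_connected_def)
  have V3: "3 \<le> card V" using card_ge_3 \<kappa> assms(6) by simp
  have two_connected: "\<exists>a\<in>A. \<exists>b\<in>V - S - A. adj a b"
    if "S \<subseteq> V" "card S \<le> 1" "A \<subseteq> V - S" "A \<noteq> {}" "A \<noteq> V - S" for S A
  proof (rule ccontr)
    assume "\<not> ?thesis"
    then have "separating V E S" using that by (intro closed_imp_separating[of S A]) auto
    then show False using connectivity_le \<kappa> assms(6) that(2) by fastforce
  qed
  have degree_sum: "p + \<kappa> \<le> card (nbrs x) + card (nbrs y) + card (nbrs z)"
    if xyz: "x \<in> V" "y \<in> V" "z \<in> V" "x \<noteq> y" "y \<noteq> z" "x \<noteq> z" "\<not> adj x y" "\<not> adj y z" "\<not> adj x z" for x y z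
  proof -
    let ?s = "card (nbrs x) + card (nbrs y) + card (nbrs z)"
    obtain m where m: "sigma3 V E = enat m" "m \<le> ?s"
      using sigma3_le[OF xyz] by (cases "sigma3 V E") auto
    have "ereal ((real p + real \<kappa>) / 3) \<le> ereal (1 / 3 * real m)"
      using assms(7) m(1) by (simp add: one_ereal_def)
    then have "real p + real \<kappa> \<le> real m" by simp
    then show ?thesis using m(2) by linarith
  qed
  have paths_ne: "{length xs | xs. is_path V E xs} \<noteq> {}"
  proof -
    have "V \<noteq> {}" using V3 by auto
    then obtain v where "v \<in> V" by blast
    then have "is_path V E [v]" by (simp add: path_iff)
    then show ?thesis by blast
  qed
  have "p \<in> {length xs | xs. is_path V E xs}"
    using Max_in[OF finite_path_lengths paths_ne] assms(4) by (simp only: longest_path_order_def)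
  then obtain P where P: "path P" "length P = p" unfolding path_iff by blast
  have path_le: "length xs \<le> p" if "path xs" for xs
  proof -
    have "length xs \<in> {length xs | xs. is_path V E xs}" using that path_iff by blast
    from Max_ge[OF finite_path_lengths this] show ?thesis using assms(4) by (simp only: longest_path_order_def)
  qed
  have nbr: "\<exists>b. adj a b \<and> b \<noteq> w" if "a \<in> V" "w \<noteq> a" for a w
  proof -
    \<comment> \<open>\<open>w\<close> need not be a vertex, hence the intersection with
      \<open>V\<close>.\<close>
    let ?S = "{w} \<inter> V"
    have "V - ?S \<noteq> {a}"
    proof
      assume "V - ?S = {a}"
      then have "V \<subseteq> {a, w}" by auto
      then have "card V \<le> card {a, w}" by (intro card_mono) auto
      then show False using V3 that by simp
    qed
    moreover have "card ?S \<le> 1" using card_mono[of "{w}" ?S] by simp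
    ultimately have "\<exists>a'\<in>{a}. \<exists>b\<in>V - ?S - {a}. adj a' b"
      using that by (intro two_connected) auto
    then show ?thesis by auto
  qed
  have p3: "3 \<le> p"
  proof -
    have "V \<noteq> {}" using V3 by auto
    then obtain v where v: "v \<in> V" by blast
    have "\<not> V \<subseteq> {v}" using card_mono[of "{v}" V] V3 by auto
    then obtain w where w: "w \<noteq> v" by blast
    obtain a where a: "adj v a" using nbr[OF v w] by blast
    then have "a \<noteq> v" by auto
    obtain b where b: "adj v b" "b \<noteq> a" using nbr[OF v \<open>a \<noteq> v\<close>] by blast
    have "path [a, v, b]" using a b v adj_V[OF a] adj_V[OF b(1)] by (auto simp: path_Cons adj_sym)
    from path_le[OF this] show ?thesis by simp
  qed
  have "\<exists>xs. cycle xs \<and> length xs = p"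
  proof (rule ccontr)
    assume no_cycle: "\<not> ?thesis"
    have longest_path: "\<exists>xs. path xs \<and> length xs = p" using P by blast
    have no_cycle: "length xs \<noteq> p" if "cycle xs" for xs using that no_cycle by blast
    interpret short_cycles V E p \<kappa>
      by unfold_locales (fact p3, fact \<kappa>, fact longest_path, fact path_le, fact no_cycle,
        fact two_connected, fact degree_sum)
    \<comment> \<open>In a complete graph the ends of \<open>P\<close> would be adjacent. So the
      connectivity is attained by a separating set.\<close>
    have "\<not> complete_graph V E"
    proof
      assume "complete_graph V E"
      moreover have "P \<noteq> []" using P p3 by auto
      then have "hd P \<in> V" "last P \<in> V" using path_subset[OF P(1)] by auto
      moreover have "hd P \<noteq> last P"
        using P(2) p3 path_distinct[OF P(1)] \<open>P \<noteq> []\<close>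
        by (simp add: hd_conv_nth last_conv_nth nth_eq_iff_index_eq)
      ultimately have "adj (hd P) (last P)" by (simp add: complete_graph_def adj_def)
      then show False using not_adj_ends[OF P] by simp
    qed
    then obtain S where S: "separating V E S" "card S = \<kappa>" using min_separating assms(6) by metis
    obtain A where A: "A \<subseteq> V - S" "A \<noteq> {}" "A \<noteq> V - S" "\<forall>a\<in>A. \<forall>b\<in>V - S - A. \<not> adj a b"
      using S(1) by (rule separating_reachable)
    have "separation S A (V - S - A)"
      using A S by (auto simp: separation_def separating_def)
    then show False using no_separation by blast
  qed
  then obtain C where C: "cycle C" "length C = p" by blast
  have is_cycle: "is_cycle V E C"
    using C by (simp add: is_cycle_def path_iff cycle_def adj_def)
  have "set C = V"
  proof (rule ccontr)
    assume "set C \<noteq> V"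
    \<comment> \<open>An edge leaving \<open>C\<close> would extend the opened cycle to a path of
      order \<open>p + 1\<close>.\<close>
    then have "\<exists>a\<in>set C. \<exists>b\<in>V - {} - set C. adj a b"
      using C by (intro two_connected) (auto simp: cycle_def path_def)
    then obtain a b where ab: "a \<in> set C" "b \<in> V" "b \<notin> set C" "adj a b" by blast
    obtain L where L: "cycle L" "set L = set C" "length L = length C" "last L = a"
      by (rule cycle_last[OF C(1) ab(1)])
    then have "path L" "L \<noteq> []" by (auto simp: cycle_def)
    then have "path (L @ [b])" using ab L(2,4) by (simp add: path_append)
    from path_le[OF this] show False using L C by simp
  qed
  then have "hamiltonian V E" using is_cycle by (auto simp: hamiltonian_def)
  moreover have "p = n"
    using C \<open>set C = V\<close> assms(3) by (auto simp: cycle_def path_def distinct_card)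
  moreover have "c = p"
  proof (rule antisym)
    have p: "p \<in> {length xs | xs. is_cycle V E xs}" using is_cycle C(2) by blast
    show "p \<le> c"
      using Max_ge[OF finite_cycle_lengths p] assms(5) by (simp only: longest_cycle_order_def)
    have "c \<in> {length xs | xs. is_cycle V E xs}"
      using Max_in[OF finite_cycle_lengths] p assms(5) unfolding longest_cycle_order_def by blast
    then obtain xs where "is_cycle V E xs" "c = length xs" by blast
    \<comment> \<open>The degenerate cycles of orders 1 and 2 are paths as well, so \<open>p\<close>
      bounds their orders too.\<close>
    then show "c \<le> p" using path_le by (simp add: is_cycle_def path_iff)
  qed
  ultimately show ?thesis by simp
qed

end
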